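(* Let $X\ge 0$ be a random variable with distribution $F$ having density $f$ and finite moments of all positive orders. Let $Y\sim G$, with density $g$, be the symmetrization of $\sqrt{X}$. If for some $c\ge 0$, $$K[g]=\int_{|x|\ge c}\frac{-\log g(x)}{1+x^2}\,dx<\infty,$$ then $X$ is M-indet on $\mathbb{R}_+$.
   Context: $\mathbb{R}_+=[0,\infty)$; densities are with respect to Lebesgue measure. "Finite moments of all positive orders" means $\mathbf{E}[X^k]<\infty$ for all $k=1,2,\ldots$. The symmetrization of the nonnegative random variable $\sqrt{X}$ is $Y=\varepsilon\sqrt{X}$, where $\varepsilon$ is independent of $X$ with $\Pr(\varepsilon=1)=\Pr(\varepsilon=-1)=1/2$; thus $Y$ is symmetric about $0$, $|Y|$ has the distribution of $\sqrt X$, and its density is $g(x)=|x|f(x^2)$, $x\in\mathbb{R}$. The integrand $-\log g(x)/(1+x^2)$ is taken to be $+\infty$ where $g(x)=0$. A nonnegative random variable $X\sim F$ with finite moments of all positive orders is M-indet (moment-indeterminate) on $\mathbb{R}_+$ if there is a probability distribution on $\mathbb{R}_+$, different from $F$, having the same moment sequence $\{\mathbf{E}[X^k]\}_{k=1}^\infty$ as $F$. *)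

theory Defs
  imports "HOL-Probability.Probability"
begin

definition stieltjes_law :: "real measure \<Rightarrow> bool" where
  "stieltjes_law F \<longleftrightarrow>
     prob_space F \<and> sets F = sets borel \<and> (AE x in F. 0 \<le> x) \<and>
     (\<forall>k\<ge>1. integrable F (\<lambda>x. x ^ k))"

definition M_indet :: "real measure \<Rightarrow> bool" where
  "M_indet F \<longleftrightarrow>
     stieltjes_law F \<and>
     (\<exists>H. stieltjes_law H \<and> H \<noteq> F \<and>
          (\<forall>k\<ge>1. (\<integral>x. x ^ k \<partial>H) = (\<integral>x. x ^ k \<partial>F)))"

definition log_integrand :: "(real \<Rightarrow> real) \<Rightarrow> real \<Rightarrow> ereal" where
  "log_integrand g x = (if g x = 0 then \<infinity> else ereal (- ln (g x) / (1 + x\<^sup>2)))"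

text \<open>
  The extended Lebesgue integral, as integral of the positive part minus integral of the
  negative part; \<^const>\<open>e2ennreal\<close> sends negative arguments to 0. If \<open>g\<close> is a
  probability density, the subtrahend is finite, since \<open>ln t \<le> t\<close>. (In general,
  \<open>\<infinity> - \<infinity> = \<infinity>\<close> in \<^typ>\<open>ereal\<close>.)
\<close>

definition log_integral :: "real \<Rightarrow> (real \<Rightarrow> real) \<Rightarrow> ereal" where
  "log_integral c g =
     enn2ereal (\<integral>\<^sup>+x\<in>{x. c \<le> \<bar>x\<bar>}. e2ennreal (log_integrand g x) \<partial>lborel) -
     enn2ereal (\<integral>\<^sup>+x\<in>{x. c \<le> \<bar>x\<bar>}. e2ennreal (- log_integrand g x) \<partial>lborel)"

end

theory Submission
  imports Defs "HOL-Computational_Algebra.Fundamental_Theorem_Algebra"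
begin

text \<open>
  Let \<open>F\<close> be the law of \<open>X\<close>. For \<open>b > 0\<close> put \<open>t0 = b\<^sup>2 - 1\<close>, a point off the half-line
  \<open>[b\<^sup>2, \<infinity>)\<close>. The idea, due to Krein, is that convergence of the logarithmic integral makes
  evaluation at \<open>t0\<close> a bounded functional on the polynomials in an \<open>L\<^sup>1\<close> space of \<open>F\<close>, and
  that such a bound leaves room for a second solution of the moment problem.

  Boundedness. If \<open>\<omega>\<close> is the harmonic measure of the plane slit along \<open>[b\<^sup>2, \<infinity>)\<close>, seen from
  \<open>t0\<close>, then \<open>ln \<bar>p t0\<bar> \<le> \<integral> ln \<bar>p\<bar> d\<omega>\<close> for every polynomial \<open>p\<close>. The substitution
  \<open>t - t0 = 1 / (cos \<psi>)\<^sup>2\<close> turns \<open>\<omega>\<close> into the uniform distribution on \<open>(0, \<pi>/2)\<close> and the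
  inequality into the fact that the logarithmic potential of the arcsine law on \<open>[0, 1]\<close> attains
  its minimum over the plane at every point of \<open>[0, 1]\<close>; this needs no more than the periodicity of
  \<open>ln \<bar>sin x\<bar>\<close>. Jensen's inequality, applied with the weight \<open>g\<close>, then gives
  \<open>\<bar>p t0\<bar> \<le> C * \<integral> \<bar>p t\<bar> / (t - t0) dF(t)\<close> over \<open>t > b\<^sup>2\<close>, with \<open>C\<close> independent of the
  degree, as soon as the negative part of \<open>ln g(sqrt t)\<close> is \<open>\<omega>\<close>-integrable. The density of \<open>\<omega>\<close> in
  the variable \<open>x = sqrt t\<close> decays like \<open>1 / (1 + x\<^sup>2)\<close> but has an inverse square root singularity
  at \<open>b\<close>, so \<open>b\<close> cannot simply be \<open>c\<close>; by Tonelli's theorem almost every \<open>b\<close> in \<open>(c, c + 1)\<close>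
  works.

  Indeterminacy. Among the polynomials of degree at most \<open>n\<close> with \<open>p t0 = 1\<close> there is one, \<open>p\<^sub>n\<close>,
  of least norm \<open>\<integral> \<bar>p t\<bar> / (t - t0) dF(t)\<close> over \<open>t > b\<^sup>2\<close>. Minimality says that the sign of
  \<open>p\<^sub>n\<close> annihilates the polynomials of degree at most \<open>n\<close> that vanish at \<open>t0\<close>. Hence the measure
  with density \<open>1 + sgn (p\<^sub>n t)\<close> for \<open>t > b\<^sup>2\<close>, and \<open>1\<close> elsewhere, relative to \<open>F\<close> is a
  probability measure with the same moments as \<open>F\<close> up to order \<open>n - 1\<close>, whereas it gives the
  function \<open>1 / (t - t0)\<close> on \<open>t > b\<^sup>2\<close> an integral that is larger by at least \<open>1 / C\<close>. All these
  measures are bounded by \<open>2 * F\<close>, so they have a weak limit point; it has all the moments of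
  \<open>F\<close>, and it still differs from \<open>F\<close>.
\<close>

section \<open>The logarithmic potential of the arcsine law\<close>

text \<open>
  The singularity at \<open>0\<close> is that of \<open>ln x\<close>, which has the continuous primitive
  \<open>x * ln x - x\<close>; the quotient \<open>sin x / x\<close> is continuous and positive.
\<close>

lemma ln_abs_sin_integrable_quarter: "(\<lambda>x. ln \<bar>sin x\<bar>) integrable_on {0..pi/2}"
proof -
  have "((\<lambda>x. ln x) has_integral
      ((\<lambda>x. x * ln x - x) (pi/2) - (\<lambda>x. x * ln x - x) 0)) {0..pi/2}"
  proof (rule fundamental_theorem_of_calculus_interior)
    have lim: "((\<lambda>x::real. x * ln x) \<longlongrightarrow> 0) (at_right 0)"
      by real_asymp
    show "continuous_on {0..pi/2} (\<lambda>x. x * ln x - x)"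
      unfolding continuous_on_eq_continuous_within
    proof
      fix x :: real
      assume x: "x \<in> {0..pi/2}"
      show "continuous (at x within {0..pi/2}) (\<lambda>x. x * ln x - x)"
      proof (cases "x = 0")
        case True
        have "((\<lambda>x::real. x * ln x) \<longlongrightarrow> 0) (at 0 within {0..pi/2})"
          using lim by (simp add: at_within_Icc_at_right)
        then have "continuous (at 0 within {0..pi/2}) (\<lambda>x::real. x * ln x)"
          by (simp add: continuous_within)
        then show ?thesis
          using True by (intro continuous_diff) auto
      next
        case False
        then show ?thesis using x by (intro continuous_intros) auto
      qed
    qed
    show "((\<lambda>x. x * ln x - x) has_vector_derivative ln x) (at x)" if "x \<in> {0<..<pi/2}" for x
      unfolding has_real_derivative_iff_has_vector_derivative[symmetric]
      using that by (auto intro!: derivative_eq_intros)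
  qed simp
  then have 1: "ln integrable_on {0..pi/2}" by (auto simp: integrable_on_def)
  have pos: "sinc x > 0" if "x \<in> {0..pi/2}" for x
    using that by (cases "x = 0") (auto simp: sin_gt_zero)
  have 2: "(\<lambda>x. ln (sinc x)) integrable_on {0..pi/2}"
    using pos by (intro integrable_continuous_real continuous_on_ln)
      (auto intro!: continuous_at_imp_continuous_on isCont_sinc simp: less_imp_neq[THEN not_sym])
  have "(\<lambda>x. ln x + ln (sinc x)) integrable_on {0..pi/2}"
    by (rule integrable_add[OF 1 2])
  then show ?thesis
  proof (rule integrable_spike[where S = "{0}"])
    fix x assume "x \<in> {0..pi/2} - {0}"
    then have "x > 0" "sin x > 0" by (auto simp: sin_gt_zero)
    then show "ln \<bar>sin x\<bar> = ln x + ln (sinc x)" by (simp add: ln_div)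
  qed simp
qed

lemma ln_abs_sin_integrable: "(\<lambda>x. ln \<bar>sin x\<bar>) integrable_on {- (pi/2)..pi}"
proof -
  let ?l = "\<lambda>x::real. ln \<bar>sin x\<bar>"
  have q: "?l integrable_on {0..pi/2}" by (rule ln_abs_sin_integrable_quarter)
  then have q1: "?l integrable_on {-(pi/2)..0}"
    using Henstock_Kurzweil_Integration.integrable_reflect_real[of "\<lambda>x. ln \<bar>sin x\<bar>" "pi/2" 0] by simp
  have "(\<lambda>x. ?l (x + (-pi))) integrable_on {-(pi/2) - (-pi)..0 - (-pi)}"
    using q1 has_integral_shift_real_ivl[of ?l _ "-(pi/2)" 0 "-pi"]
    unfolding integrable_on_def by blast
  then have q2: "?l integrable_on {pi/2..pi}" by (simp add: sin_diff)
  have "?l integrable_on {-(pi/2)..pi/2}"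
    using q1 q by (rule Henstock_Kurzweil_Integration.integrable_combine[rotated 2]) auto
  from this q2 show ?thesis
    by (rule Henstock_Kurzweil_Integration.integrable_combine[rotated 2]) auto
qed

definition ln_sin_period_integral :: real where
  "ln_sin_period_integral = integral {- (pi/2)..pi/2} (\<lambda>x. ln \<bar>sin x\<bar>)"

text \<open>
  Since \<open>(cos x)\<^sup>2 - (cos \<phi>)\<^sup>2 = - sin (x + \<phi>) * sin (x - \<phi>)\<close>, the integral is that of
  \<open>ln \<bar>sin\<bar>\<close> over the interval from \<open>\<phi> - \<pi>/2\<close> to \<open>\<phi> + \<pi>/2\<close>, which is one full period, so that
  it does not depend on \<open>\<phi>\<close>.
\<close>

lemma has_integral_ln_cos_square_diff:
  assumes "0 \<le> \<phi>" "\<phi> \<le> pi/2"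
  shows "((\<lambda>x. ln \<bar>(cos x)\<^sup>2 - (cos \<phi>)\<^sup>2\<bar>) has_integral ln_sin_period_integral) {0..pi/2}"
proof -
  let ?l = "\<lambda>x::real. ln \<bar>sin x\<bar>"
  let ?I = "\<lambda>a b. integral {a..b} ?l"
  have int: "?l integrable_on {a..b}" if "- (pi/2) \<le> a" "b \<le> pi" for a b
    using ln_abs_sin_integrable by (rule integrable_on_subinterval) (use that in auto)
  have hi: "(?l has_integral ?I a b) {a..b}" if "- (pi/2) \<le> a" "b \<le> pi" for a b
    using int[OF that] by (rule integrable_integral)
  have A: "((\<lambda>x. ?l (x + \<phi>)) has_integral ?I \<phi> (\<phi> + pi/2)) {0..pi/2}"
    using has_integral_shift_real_ivl[OF hi[of \<phi> "\<phi> + pi/2"], of \<phi>] assms by simp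
  have "((\<lambda>x. ?l (- x)) has_integral ?I (\<phi> - pi/2) \<phi>) {- \<phi>..pi/2 - \<phi>}"
    using hi[of "\<phi> - pi/2" \<phi>] assms has_integral_reflect_real[of "?l" "?I (\<phi> - pi/2) \<phi>" "\<phi>" "\<phi> - pi/2"] by simp
  then have "(?l has_integral ?I (\<phi> - pi/2) \<phi>) {- \<phi>..pi/2 - \<phi>}" by simp
  from has_integral_shift_real_ivl[OF this, of "- \<phi>"]
  have B: "((\<lambda>x. ?l (x - \<phi>)) has_integral ?I (\<phi> - pi/2) \<phi>) {0..pi/2}" by simp
  have "((\<lambda>x. ?l (x + pi)) has_integral ?I (pi/2) (\<phi> + pi/2)) {-(pi/2)..\<phi> - pi/2}"
    using has_integral_shift_real_ivl[OF hi[of "pi/2" "\<phi> + pi/2"], of pi] assms by (simp add: field_simps)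
  then have per: "?I (pi/2) (\<phi> + pi/2) = ?I (-(pi/2)) (\<phi> - pi/2)" by (simp add: integral_unique)
  have c1: "?I (\<phi> - pi/2) \<phi> + ?I \<phi> (\<phi> + pi/2) = ?I (\<phi> - pi/2) (\<phi> + pi/2)"
    using assms by (intro Henstock_Kurzweil_Integration.integral_combine int) auto
  have c2: "?I (\<phi> - pi/2) (pi/2) + ?I (pi/2) (\<phi> + pi/2) = ?I (\<phi> - pi/2) (\<phi> + pi/2)"
    using assms by (intro Henstock_Kurzweil_Integration.integral_combine int) auto
  have c3: "?I (-(pi/2)) (\<phi> - pi/2) + ?I (\<phi> - pi/2) (pi/2) = ln_sin_period_integral"
    unfolding ln_sin_period_integral_def
    using assms by (intro Henstock_Kurzweil_Integration.integral_combine int) auto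
  have "((\<lambda>x. ?l (x + \<phi>) + ?l (x - \<phi>)) has_integral ln_sin_period_integral) {0..pi/2}"
  proof -
    have "?I \<phi> (\<phi> + pi/2) + ?I (\<phi> - pi/2) \<phi> = ln_sin_period_integral" using c1 c2 c3 per by linarith
    then show ?thesis using has_integral_add[OF A B] by simp
  qed
  then show ?thesis
  proof (rule has_integral_spike[where S = "{\<phi>}", rotated 2])
    fix x assume x: "x \<in> {0..pi/2} - {\<phi>}"
    have "sin (x + \<phi>) * sin (x - \<phi>) = (sin x)\<^sup>2 * (cos \<phi>)\<^sup>2 - (cos x)\<^sup>2 * (sin \<phi>)\<^sup>2"
      by (simp add: sin_add sin_diff algebra_simps power2_eq_square)
    then have e: "(cos x)\<^sup>2 - (cos \<phi>)\<^sup>2 = - (sin (x + \<phi>) * sin (x - \<phi>))"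
      by (simp add: sin_squared_eq algebra_simps)
    have "sin (x + \<phi>) > 0" using x assms by (intro sin_gt_zero) auto
    moreover have "sin (x - \<phi>) \<noteq> 0"
    proof (cases "x > \<phi>")
      case True
      then have "sin (x - \<phi>) > 0" using x assms by (intro sin_gt_zero) auto
      then show ?thesis by simp
    next
      case False
      then have "sin (\<phi> - x) > 0" using x assms by (intro sin_gt_zero) auto
      then show ?thesis using sin_minus[of "\<phi> - x"] by simp
    qed
    ultimately show "ln \<bar>(cos x)\<^sup>2 - (cos \<phi>)\<^sup>2\<bar> = ?l (x + \<phi>) + ?l (x - \<phi>)"
      unfolding e by (simp add: abs_mult ln_mult_pos)
  qed simp
qed

lemma cos_square_surj:
  fixes r :: real
  assumes "0 \<le> r" "r \<le> 1"
  obtains \<phi> where "0 \<le> \<phi>" "\<phi> \<le> pi/2" "(cos \<phi>)\<^sup>2 = r"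
proof
  have s: "0 \<le> sqrt r" "sqrt r \<le> 1" "- 1 \<le> sqrt r"
    using assms by (auto intro: order_trans[of _ 0])
  show "0 \<le> arccos (sqrt r)" using s by (intro arccos_lbound) auto
  show "arccos (sqrt r) \<le> pi/2" using s by (intro arccos_le_pi2) auto
  show "(cos (arccos (sqrt r)))\<^sup>2 = r" using s assms by simp
qed

lemma inj_on_cos_square: "inj_on (\<lambda>x::real. (cos x)\<^sup>2) {0..pi/2}"
proof (rule inj_onI)
  fix x y :: real
  assume *: "x \<in> {0..pi/2}" "y \<in> {0..pi/2}" "(cos x)\<^sup>2 = (cos y)\<^sup>2"
  have "cos x \<ge> 0" "cos y \<ge> 0" using * by (auto intro!: cos_ge_zero)
  with *(3) have "cos x = cos y" by simp
  with * show "x = y" by (auto intro: cos_inj_pi[of x y])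
qed

text \<open>
  On \<open>[0, 1]\<close> the potential is constant, and replacing \<open>\<eta>\<close> by the nearest point of \<open>[0, 1]\<close>
  does not increase any of the distances \<open>\<bar>(cos x)\<^sup>2 - \<eta>\<bar>\<close>. This is the only inequality behind the
  harmonic measure estimate; equality at \<open>\<eta> = 0\<close> matters as well.
\<close>

lemma ln_dist_cos_square_ge:
  fixes \<eta> :: complex
  shows "(\<lambda>x. ln (cmod (of_real ((cos x)\<^sup>2) - \<eta>))) integrable_on {0..pi/2}" (is "?f integrable_on _")
    and "ln_sin_period_integral \<le> integral {0..pi/2} (\<lambda>x. ln (cmod (of_real ((cos x)\<^sup>2) - \<eta>)))"
proof -
  have "?f integrable_on {0..pi/2} \<and> ln_sin_period_integral \<le> integral {0..pi/2} ?f"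
  proof (cases "Im \<eta> = 0 \<and> 0 \<le> Re \<eta> \<and> Re \<eta> \<le> 1")
    case True
    then obtain \<phi> where \<phi>: "0 \<le> \<phi>" "\<phi> \<le> pi/2" "(cos \<phi>)\<^sup>2 = Re \<eta>"
      using cos_square_surj by blast
    have "\<eta> = of_real ((cos \<phi>)\<^sup>2)" using \<phi>(3) True by (simp add: complex_eq_iff)
    then have "?f = (\<lambda>x. ln \<bar>(cos x)\<^sup>2 - (cos \<phi>)\<^sup>2\<bar>)"
      by (simp add: fun_eq_iff flip: of_real_power of_real_diff)
    then show ?thesis
      using has_integral_ln_cos_square_diff[OF \<phi>(1,2)] by (auto simp: integrable_on_def integral_unique)
  next
    case False
    \<comment> \<open>The point of \<open>[0, 1]\<close> nearest to \<open>\<eta>\<close>.\<close>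
    define r where "r = min 1 (max 0 (Re \<eta>))"
    have "0 \<le> r" "r \<le> 1" unfolding r_def by auto
    then obtain \<phi> where \<phi>: "0 \<le> \<phi>" "\<phi> \<le> pi/2" "(cos \<phi>)\<^sup>2 = r"
      using cos_square_surj by blast
    note h = has_integral_ln_cos_square_diff[OF \<phi>(1,2)]
    have y: "0 \<le> (cos x)\<^sup>2" "(cos x)\<^sup>2 \<le> 1" for x :: real
      by (auto simp: abs_square_le_1)
    have ne: "of_real ((cos x)\<^sup>2) \<noteq> \<eta>" for x :: real
    proof
      assume "of_real ((cos x)\<^sup>2) = \<eta>"
      then have "Im \<eta> = 0" "Re \<eta> = (cos x)\<^sup>2" by (auto simp del: of_real_power)
      then show False using False y[of x] by simp
    qed
    have int: "?f integrable_on {0..pi/2}"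
      using ne by (intro integrable_continuous_real continuous_intros) auto
    have le: "\<bar>(cos x)\<^sup>2 - r\<bar> \<le> cmod (of_real ((cos x)\<^sup>2) - \<eta>)" for x :: real
    proof -
      have "\<bar>(cos x)\<^sup>2 - r\<bar> \<le> \<bar>(cos x)\<^sup>2 - Re \<eta>\<bar>" using y[of x] unfolding r_def by linarith
      also have "\<dots> \<le> cmod (of_real ((cos x)\<^sup>2) - \<eta>)"
        using abs_Re_le_cmod[of "of_real ((cos x)\<^sup>2) - \<eta>"] by simp
      finally show ?thesis .
    qed
    \<comment> \<open>At \<open>x = \<phi>\<close> the lower function takes the value \<open>ln 0 = 0\<close>, which need not be a lower bound.\<close>
    have "((\<lambda>x. if x = \<phi> then ?f x else ln \<bar>(cos x)\<^sup>2 - (cos \<phi>)\<^sup>2\<bar>) has_integral ln_sin_period_integral) {0..pi/2}"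
      using h by (rule has_integral_spike[where S = "{\<phi>}", rotated 2]) auto
    then have "ln_sin_period_integral \<le> integral {0..pi/2} ?f"
    proof (rule has_integral_le[OF _ integrable_integral[OF int]])
      fix x assume x: "x \<in> {0..pi/2}"
      show "(if x = \<phi> then ?f x else ln \<bar>(cos x)\<^sup>2 - (cos \<phi>)\<^sup>2\<bar>) \<le> ?f x"
      proof (cases "x = \<phi>")
        case False
        have "(cos x)\<^sup>2 \<noteq> (cos \<phi>)\<^sup>2"
          using inj_onD[OF inj_on_cos_square, of x \<phi>] False x \<phi>(1,2) by auto
        then have "ln \<bar>(cos x)\<^sup>2 - (cos \<phi>)\<^sup>2\<bar> \<le> ?f x"
          using le[of x] \<phi>(3) by (intro ln_mono) auto
        then show ?thesis using False by simp
      qed simp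
    qed
    then show ?thesis using int by simp
  qed
  then show "?f integrable_on {0..pi/2}" "ln_sin_period_integral \<le> integral {0..pi/2} ?f" by auto
qed

text \<open>
  Sum of the potential bounds over the linear factors of \<open>R\<close>. A real function that vanishes at a
  zero of \<open>R\<close> has \<open>ln 0 = 0\<close> there, so the factorisation of the logarithm holds only outside a
  finite set.
\<close>

lemma ln_poly_cos_square_ge:
  fixes R :: "complex poly"
  assumes "R \<noteq> 0"
  shows "(\<lambda>x. ln (cmod (poly R (of_real ((cos x)\<^sup>2))))) integrable_on {0..pi/2}"
    and "pi/2 * ln (cmod (lead_coeff R)) + degree R * ln_sin_period_integral
       \<le> integral {0..pi/2} (\<lambda>x. ln (cmod (poly R (of_real ((cos x)\<^sup>2)))))"
proof -
  let ?f = "\<lambda>x. ln (cmod (poly R (of_real ((cos x)\<^sup>2))))"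
  obtain root where root: "smult (lead_coeff R) (\<Prod>i<degree R. [:-root i, 1:]) = R"
    by (rule complex_poly_decompose')
  let ?g = "\<lambda>i x. ln (cmod (of_real ((cos x)\<^sup>2) - root i))"
  define L where "L = (\<lambda>x. ln (cmod (lead_coeff R)) + (\<Sum>i<degree R. ?g i x))"
  define Z where "Z = {x \<in> {0..pi/2}. poly R (of_real ((cos x)\<^sup>2)) = 0}"
  have "inj_on (\<lambda>x. of_real ((cos x)\<^sup>2) :: complex) {0..pi/2}"
    using inj_on_cos_square unfolding inj_on_def of_real_eq_iff .
  from finite_vimage_IntI[OF poly_roots_finite[OF assms] this]
  have "finite Z" by (rule finite_subset[rotated]) (auto simp: Z_def)
  then have neg: "negligible Z" by (rule negligible_finite)
  have eq: "?f x = L x" if "x \<in> {0..pi/2} - Z" for x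
  proof -
    let ?z = "of_real ((cos x)\<^sup>2) :: complex"
    have p: "poly R ?z = lead_coeff R * (\<Prod>i<degree R. ?z - root i)"
      by (subst root[symmetric]) (simp add: poly_prod)
    moreover have "poly R ?z \<noteq> 0" using that unfolding Z_def by auto
    ultimately have nz: "\<And>i. i < degree R \<Longrightarrow> ?z - root i \<noteq> 0" by auto
    have "cmod (poly R ?z) = cmod (lead_coeff R) * (\<Prod>i<degree R. cmod (?z - root i))"
      unfolding p by (simp add: norm_mult prod_norm)
    moreover have "ln (\<Prod>i<degree R. cmod (?z - root i)) = (\<Sum>i<degree R. ?g i x)"
      using nz by (intro ln_prod) auto
    moreover have "(\<Prod>i<degree R. cmod (?z - root i)) > 0"
      using nz by (intro prod_pos) auto
    ultimately show ?thesis unfolding L_def using assms by (simp add: ln_mult_pos)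
  qed
  have intL: "L integrable_on {0..pi/2}"
    unfolding L_def by (intro integrable_add integrable_sum ln_dist_cos_square_ge) auto
  show "?f integrable_on {0..pi/2}"
    using intL neg eq by (rule integrable_spike)
  have "integral {0..pi/2} ?f = integral {0..pi/2} L"
    using neg eq by (intro integral_spike[symmetric]) auto
  also have "\<dots> = integral {0..pi/2} (\<lambda>x. ln (cmod (lead_coeff R)))
      + integral {0..pi/2} (\<lambda>x. \<Sum>i<degree R. ?g i x)"
    unfolding L_def
    by (rule Henstock_Kurzweil_Integration.integral_add)
      (auto simp del: of_real_power intro!: integrable_sum ln_dist_cos_square_ge)
  also have "integral {0..pi/2} (\<lambda>x. \<Sum>i<degree R. ?g i x)
      = (\<Sum>i<degree R. integral {0..pi/2} (?g i))"
    by (rule Henstock_Kurzweil_Integration.integral_sum) (auto simp del: of_real_power intro!: ln_dist_cos_square_ge)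
  finally have eq': "integral {0..pi/2} ?f = pi/2 * ln (cmod (lead_coeff R))
      + (\<Sum>i<degree R. integral {0..pi/2} (?g i))"
    by (simp del: of_real_power)
  have "(\<Sum>i<degree R. ln_sin_period_integral) \<le> (\<Sum>i<degree R. integral {0..pi/2} (?g i))"
    by (intro sum_mono ln_dist_cos_square_ge)
  then show "pi/2 * ln (cmod (lead_coeff R)) + degree R * ln_sin_period_integral \<le> integral {0..pi/2} ?f"
    unfolding eq' by simp
qed

lemma poly_map_poly_of_real:
  "poly (map_poly complex_of_real p) (of_real x) = of_real (poly p x)"
  by (induction p) (auto simp: map_poly_pCons)

lemma finite_poly_sec_square_roots:
  fixes q :: "real poly"
  assumes "q \<noteq> 0"
  shows "finite {x \<in> {0..pi/2}. poly q (1 / (cos x)\<^sup>2) = 0}"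
proof -
  have "inj_on (\<lambda>x::real. 1 / (cos x)\<^sup>2) {0..pi/2}"
    using inj_on_cos_square by (simp add: inj_on_def)
  from finite_vimage_IntI[OF poly_roots_finite[OF assms] this]
  show ?thesis by (rule finite_subset[rotated]) auto
qed

text \<open>
  The harmonic measure inequality for the plane slit along \<open>[1, \<infinity>)\<close>, with base point \<open>0\<close>: the
  image of the uniform distribution on \<open>(0, \<pi>/2)\<close> under \<open>1 / (cos x)\<^sup>2\<close> is the harmonic measure.
  With \<open>y = (cos x)\<^sup>2\<close> one has \<open>q (1 / y) = R y / y ^ degree q\<close> for the reflected polynomial \<open>R\<close>,
  whose leading coefficient is \<open>q 0\<close>; the potential at \<open>0\<close> is exactly \<open>ln_sin_period_integral\<close>, so the
  contributions of the degree cancel.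
\<close>

lemma ln_poly_sec_square_ge:
  fixes q :: "real poly"
  assumes q0: "poly q 0 \<noteq> 0"
  shows "(\<lambda>x. ln \<bar>poly q (1 / (cos x)\<^sup>2)\<bar>) integrable_on {0..pi/2}"
    and "pi/2 * ln \<bar>poly q 0\<bar> \<le> integral {0..pi/2} (\<lambda>x. ln \<bar>poly q (1 / (cos x)\<^sup>2)\<bar>)"
proof -
  let ?f = "\<lambda>x. ln \<bar>poly q (1 / (cos x)\<^sup>2)\<bar>"
  define R where "R = map_poly complex_of_real (reflect_poly q)"
  have c0: "coeff q 0 \<noteq> 0" using q0 by (simp add: poly_0_coeff_0)
  have deg: "degree R = degree q" unfolding R_def using c0 by (simp add: degree_map_poly)
  have lc: "lead_coeff R = of_real (poly q 0)"
    unfolding deg unfolding R_def using c0 by (simp add: coeff_map_poly coeff_reflect_poly poly_0_coeff_0)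
  have R0: "R \<noteq> 0" using lc q0 by auto
  have pR: "cmod (poly R (of_real y)) = \<bar>poly (reflect_poly q) y\<bar>" for y
    unfolding R_def by (simp add: poly_map_poly_of_real)
  let ?g = "\<lambda>x. ln (cmod (poly R (of_real ((cos x)\<^sup>2))))"
  let ?h = "\<lambda>x. ln \<bar>(cos x)\<^sup>2 - (cos (pi/2))\<^sup>2\<bar>"
  note h = has_integral_ln_cos_square_diff[of "pi/2"]
  define Z where "Z = insert (pi/2) {x \<in> {0..pi/2}. poly q (1 / (cos x)\<^sup>2) = 0}"
  have "finite Z" unfolding Z_def finite_insert
    using q0 by (intro finite_poly_sec_square_roots) auto
  then have neg: "negligible Z" by (rule negligible_finite)
  have eq: "?f x = ?g x - degree q * ?h x" if "x \<in> {0..pi/2} - Z" for x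
  proof -
    have c: "cos x > 0" using that unfolding Z_def by (auto intro!: cos_gt_zero_pi)
    have "poly q (1 / (cos x)\<^sup>2) \<noteq> 0" using that unfolding Z_def by auto
    moreover have "poly (reflect_poly q) ((cos x)\<^sup>2) = ((cos x)\<^sup>2) ^ degree q * poly q (1 / (cos x)\<^sup>2)"
      using c by (subst poly_reflect_poly_nz) (auto simp: divide_inverse)
    ultimately show ?thesis
      using c unfolding pR by (simp add: abs_mult ln_mult_pos ln_realpow)
  qed
  have ih: "(\<lambda>x. degree q * ?h x) integrable_on {0..pi/2}"
    using h by (intro integrable_on_mult_right) (auto simp: integrable_on_def)
  have i: "(\<lambda>x. ?g x - degree q * ?h x) integrable_on {0..pi/2}"
    by (rule integrable_diff[OF ln_poly_cos_square_ge(1)[OF R0] ih])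
  then show "?f integrable_on {0..pi/2}" using neg eq by (rule integrable_spike)
  have "integral {0..pi/2} ?f = integral {0..pi/2} (\<lambda>x. ?g x - degree q * ?h x)"
    using neg eq by (intro integral_spike[symmetric]) auto
  also have "\<dots> = integral {0..pi/2} ?g - degree q * integral {0..pi/2} ?h"
    by (simp only: Henstock_Kurzweil_Integration.integral_diff[OF ln_poly_cos_square_ge(1)[OF R0] ih]
        integral_mult_right)
  also have "integral {0..pi/2} ?h = ln_sin_period_integral" using h by (simp add: integral_unique)
  finally show "pi/2 * ln \<bar>poly q 0\<bar> \<le> integral {0..pi/2} ?f"
    using ln_poly_cos_square_ge(2)[OF R0] unfolding deg lc[unfolded deg] by simp
qed

section \<open>Polynomials off a half-line and logarithmic integrals\<close>

text \<open>
  The variable \<open>x = sqrt t\<close> in terms of the angle: \<open>x\<^sup>2 - b\<^sup>2 + 1 = 1 / (cos \<psi>)\<^sup>2\<close>.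
\<close>

definition slit_param :: "real \<Rightarrow> real \<Rightarrow> real" where
  "slit_param b \<psi> = sqrt (b\<^sup>2 + (tan \<psi>)\<^sup>2)"

lemma slit_param_gt:
  assumes "0 < b" "\<psi> \<in> {0<..<pi/2}"
  shows "b < slit_param b \<psi>"
proof -
  have "tan \<psi> > 0" using assms by (intro tan_gt_zero) auto
  then show ?thesis using assms unfolding slit_param_def by (intro real_less_rsqrt) simp
qed

lemma slit_param_square: "(slit_param b \<psi>)\<^sup>2 - b\<^sup>2 = (tan \<psi>)\<^sup>2"
  unfolding slit_param_def by simp

lemma slit_param_image:
  assumes "0 < b"
  shows "slit_param b ` {0<..<pi/2} = {b<..}"
proof (intro equalityI subsetI)
  fix x assume x: "x \<in> {b<..}"
  then have p: "x\<^sup>2 - b\<^sup>2 > 0" using assms by (simp add: power_strict_mono)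
  have "slit_param b (arctan (sqrt (x\<^sup>2 - b\<^sup>2))) = x"
    using p x assms unfolding slit_param_def by (simp add: tan_arctan)
  moreover have "arctan (sqrt (x\<^sup>2 - b\<^sup>2)) \<in> {0<..<pi/2}"
    using p arctan_ubound[of "sqrt (x\<^sup>2 - b\<^sup>2)"] by simp
  ultimately show "x \<in> slit_param b ` {0<..<pi/2}" by (metis imageI)
qed (use slit_param_gt[OF assms] in auto)

lemma inj_on_slit_param: "inj_on (slit_param b) {0<..<pi/2}"
proof (rule inj_onI)
  fix x y assume *: "x \<in> {0<..<pi/2}" "y \<in> {0<..<pi/2}" "slit_param b x = slit_param b y"
  have "(tan x)\<^sup>2 = (tan y)\<^sup>2" using slit_param_square[of b x] slit_param_square[of b y] *(3) by simp
  moreover have "tan x > 0" "tan y > 0" using * by (auto intro!: tan_gt_zero)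
  ultimately have "tan x = tan y" by (simp add: power2_eq_iff)
  then show "x = y" using * tan_monotone'[of x y] tan_monotone'[of y x] by force
qed

lemma slit_param_has_derivative:
  assumes "0 < b" "\<psi> \<in> {0<..<pi/2}"
  shows "(slit_param b has_field_derivative
     tan \<psi> * (1 + (tan \<psi>)\<^sup>2) / slit_param b \<psi>) (at \<psi> within {0<..<pi/2})"
proof -
  have c: "cos \<psi> > 0" using assms by (intro cos_gt_zero) auto
  have p: "b\<^sup>2 + (tan \<psi>)\<^sup>2 > 0" using assms by (simp add: add_pos_nonneg)
  have t: "inverse ((cos \<psi>)\<^sup>2) = 1 + (tan \<psi>)\<^sup>2" using c by (simp add: tan_sec power_inverse)
  have d: "((\<lambda>\<psi>. sqrt (b\<^sup>2 + (tan \<psi>)\<^sup>2)) has_field_derivative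
      (inverse (sqrt (b\<^sup>2 + (tan \<psi>)\<^sup>2)) / 2) * (2 * tan \<psi> * inverse ((cos \<psi>)\<^sup>2))) (at \<psi>)"
    using c p by (auto intro!: derivative_eq_intros)
  have e: "(inverse (sqrt (b\<^sup>2 + (tan \<psi>)\<^sup>2)) / 2) * (2 * tan \<psi> * inverse ((cos \<psi>)\<^sup>2))
      = tan \<psi> * (1 + (tan \<psi>)\<^sup>2) / sqrt (b\<^sup>2 + (tan \<psi>)\<^sup>2)"
  proof -
    have "(inverse s / 2) * (2 * u * v) = u * v / s" for s u v :: real
      by (simp add: field_simps)
    then show ?thesis unfolding t .
  qed
  show ?thesis
    using has_field_derivative_at_within[OF d[unfolded e]] unfolding slit_param_def .
qed

lemma slit_change_of_variables:
  fixes f :: "real \<Rightarrow> real"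
  assumes b: "0 < b"
  shows "(\<lambda>\<psi>. tan \<psi> * (1 + (tan \<psi>)\<^sup>2) / slit_param b \<psi> * f (slit_param b \<psi>)) absolutely_integrable_on {0<..<pi/2} \<and>
         integral {0<..<pi/2} (\<lambda>\<psi>. tan \<psi> * (1 + (tan \<psi>)\<^sup>2) / slit_param b \<psi> * f (slit_param b \<psi>)) = I
     \<longleftrightarrow> f absolutely_integrable_on {b<..} \<and> integral {b<..} f = I"
proof -
  have p: "\<bar>tan \<psi> * (1 + (tan \<psi>)\<^sup>2) / slit_param b \<psi>\<bar> = tan \<psi> * (1 + (tan \<psi>)\<^sup>2) / slit_param b \<psi>"
    if "\<psi> \<in> {0<..<pi/2}" for \<psi>
    using that tan_gt_zero[of \<psi>] slit_param_gt[OF b that] b by (intro abs_of_nonneg) auto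
  have "(\<lambda>\<psi>. \<bar>tan \<psi> * (1 + (tan \<psi>)\<^sup>2) / slit_param b \<psi>\<bar> * f (slit_param b \<psi>)) absolutely_integrable_on {0<..<pi/2} \<and>
         integral {0<..<pi/2} (\<lambda>\<psi>. \<bar>tan \<psi> * (1 + (tan \<psi>)\<^sup>2) / slit_param b \<psi>\<bar> * f (slit_param b \<psi>)) = I
     \<longleftrightarrow> f absolutely_integrable_on (slit_param b ` {0<..<pi/2}) \<and> integral (slit_param b ` {0<..<pi/2}) f = I"
    by (rule has_absolute_integral_change_of_variables_1')
      (auto intro: slit_param_has_derivative[OF b] inj_on_slit_param)
  also have "integral {0<..<pi/2} (\<lambda>\<psi>. \<bar>tan \<psi> * (1 + (tan \<psi>)\<^sup>2) / slit_param b \<psi>\<bar> * f (slit_param b \<psi>))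
     = integral {0<..<pi/2} (\<lambda>\<psi>. tan \<psi> * (1 + (tan \<psi>)\<^sup>2) / slit_param b \<psi> * f (slit_param b \<psi>))"
    using p by (intro Henstock_Kurzweil_Integration.integral_cong) simp
  also have "(\<lambda>\<psi>. \<bar>tan \<psi> * (1 + (tan \<psi>)\<^sup>2) / slit_param b \<psi>\<bar> * f (slit_param b \<psi>)) absolutely_integrable_on {0<..<pi/2}
     \<longleftrightarrow> (\<lambda>\<psi>. tan \<psi> * (1 + (tan \<psi>)\<^sup>2) / slit_param b \<psi> * f (slit_param b \<psi>)) absolutely_integrable_on {0<..<pi/2}"
    using p by (intro set_integrable_cong) simp_all
  finally show ?thesis unfolding slit_param_image[OF b] .
qed

text \<open>
  Jensen's inequality for the logarithm, in the form \<open>ln z \<le> z - 1\<close> with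
  \<open>z = \<bar>q\<bar> * W / J\<close>, where \<open>J\<close> is slightly more than the mean of \<open>\<bar>q\<bar> * W\<close>. The point is that the
  constant depends on \<open>W\<close> only.
\<close>

lemma polynomial_value_bound_jensen:
  fixes q :: "real poly"
  assumes q0: "poly q 0 \<noteq> 0"
    and N: "N integrable_on {0..pi/2}"
    and W: "(\<lambda>x. \<bar>poly q (1 / (cos x)\<^sup>2)\<bar> * W x) integrable_on {0..pi/2}"
    and pos: "\<And>x. x \<in> {0<..<pi/2} \<Longrightarrow> W x > 0"
    and le: "\<And>x. x \<in> {0<..<pi/2} \<Longrightarrow> - ln (W x) \<le> N x"
  shows "\<bar>poly q 0\<bar> \<le> exp (2/pi * integral {0..pi/2} N) * (2/pi)
      * integral {0..pi/2} (\<lambda>x. \<bar>poly q (1 / (cos x)\<^sup>2)\<bar> * W x)"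
    (is "_ \<le> ?E * (2/pi) * ?I")
proof -
  let ?q = "\<lambda>x. \<bar>poly q (1 / (cos x)\<^sup>2)\<bar>"
  have "q \<noteq> 0" using q0 by auto
  define Z where "Z = {0, pi/2} \<union> {x \<in> {0..pi/2}. poly q (1 / (cos x)\<^sup>2) = 0}"
  have Z: "negligible Z"
    using finite_poly_sec_square_roots[OF \<open>q \<noteq> 0\<close>] unfolding Z_def
    by (intro negligible_finite) auto
  have I0: "0 \<le> ?I"
  proof -
    have "0 \<le> integral {0<..<pi/2} (\<lambda>x. ?q x * W x)"
      using W pos by (intro Henstock_Kurzweil_Integration.integral_nonneg)
        (auto simp: integrable_on_Icc_iff_Ioo less_imp_le)
    then show ?thesis by (simp add: integral_open_interval_real)
  qed
  \<comment> \<open>The positive \<open>\<delta>\<close> keeps the normalising constant \<open>J\<close> away from \<open>0\<close>.\<close>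
  have key: "\<bar>poly q 0\<bar> \<le> ?E * (2/pi) * (?I + \<delta>)" if "\<delta> > 0" for \<delta>
  proof -
    define J where "J = 2/pi * (?I + \<delta>)"
    have J: "J > 0" unfolding J_def using I0 that by (intro mult_pos_pos) auto
    define L where "L = (\<lambda>x. ln (?q x) - N x)"
    define U where "U = (\<lambda>x. ?q x * W x * inverse J + (ln J - 1))"
    have L: "(L has_integral (integral {0..pi/2} (\<lambda>x. ln (?q x)) - integral {0..pi/2} N)) {0..pi/2}"
      unfolding L_def using ln_poly_sec_square_ge(1)[OF q0] N
      by (intro has_integral_diff integrable_integral)
    have U: "(U has_integral (?I * inverse J + pi/2 * (ln J - 1))) {0..pi/2}"
      unfolding U_def using W has_integral_const_real[of "ln J - 1" 0 "pi/2"]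
      by (intro has_integral_add has_integral_mult_left integrable_integral) auto
    have "((\<lambda>x. if x \<in> Z then U x else L x) has_integral
        (integral {0..pi/2} (\<lambda>x. ln (?q x)) - integral {0..pi/2} N)) {0..pi/2}"
      by (rule has_integral_spike[OF Z _ L]) auto
    then have "integral {0..pi/2} (\<lambda>x. ln (?q x)) - integral {0..pi/2} N
        \<le> ?I * inverse J + pi/2 * (ln J - 1)"
    proof (rule has_integral_le[OF _ U])
      fix x assume x: "x \<in> {0..pi/2}"
      show "(if x \<in> Z then U x else L x) \<le> U x"
      proof (cases "x \<in> Z")
        case False
        then have x': "x \<in> {0<..<pi/2}" and q: "?q x > 0"
          using x unfolding Z_def by auto
        have "ln (?q x * W x * inverse J) \<le> ?q x * W x * inverse J - 1"
          using pos[OF x'] q J by (intro ln_le_minus_one) auto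
        moreover have "ln (?q x * W x * inverse J) = ln (?q x) + ln (W x) - ln J"
          using pos[OF x'] q J by (simp add: ln_mult_pos ln_inverse)
        ultimately show ?thesis using False le[OF x'] unfolding L_def U_def by simp
      qed simp
    qed
    moreover have "?I * inverse J \<le> pi/2"
      unfolding J_def using I0 that by (simp add: field_simps)
    moreover have "pi/2 * ln \<bar>poly q 0\<bar> \<le> integral {0..pi/2} (\<lambda>x. ln (?q x))"
      by (rule ln_poly_sec_square_ge(2)[OF q0])
    ultimately have "pi/2 * ln \<bar>poly q 0\<bar> \<le> integral {0..pi/2} N + pi/2 * ln J"
      using right_diff_distrib[of "pi/2" "ln J" 1] by linarith
    then have "ln \<bar>poly q 0\<bar> \<le> 2/pi * integral {0..pi/2} N + ln J"
      by (simp add: field_simps)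
    then have "exp (ln \<bar>poly q 0\<bar>) \<le> exp (2/pi * integral {0..pi/2} N + ln J)"
      by simp
    then have "\<bar>poly q 0\<bar> \<le> ?E * J" using q0 J by (simp add: exp_add)
    then show ?thesis unfolding J_def by (simp add: mult.assoc)
  qed
  show ?thesis
  proof (rule field_le_epsilon)
    fix e :: real assume e: "e > 0"
    have "?E * (2/pi) > 0" by (intro mult_pos_pos) auto
    then have "e / (?E * (2/pi)) > 0" and "?E * (2/pi) * (e / (?E * (2/pi))) = e"
      using e by auto
    with key[of "e / (?E * (2/pi))"] show "\<bar>poly q 0\<bar> \<le> ?E * (2/pi) * ?I + e"
      by (simp only: distrib_left)
  qed
qed

text \<open>
  The kernel in the hypothesis is, up to a constant factor, the density of harmonic measure in the
  variable \<open>x\<close>: it is the reciprocal of the derivative of \<open>slit_param b\<close>. In the angle, the weight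
  \<open>g x / (1 + x\<^sup>2 - b\<^sup>2)\<close> becomes \<open>g x * tan \<psi> / x\<close>, which is at least
  \<open>g x * sin \<psi> / sqrt (1 + b\<^sup>2)\<close>; so its logarithm is bounded below by an integrable function.
\<close>

lemma polynomial_value_bound_of_log_integral:
  fixes g :: "real \<Rightarrow> real"
  assumes b: "0 < b" and g: "\<And>x. b < x \<Longrightarrow> 0 < g x"
    and N: "(\<lambda>x. max 0 (- ln (g x)) * (x / (sqrt (x\<^sup>2 - b\<^sup>2) * (1 + x\<^sup>2 - b\<^sup>2))))
      absolutely_integrable_on {b<..}"
  obtains C where "0 < C"
    "\<And>q :: real poly. (\<lambda>x. \<bar>poly q (1 + x\<^sup>2 - b\<^sup>2)\<bar> * (g x / (1 + x\<^sup>2 - b\<^sup>2))) absolutely_integrable_on {b<..} \<Longrightarrow>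
      \<bar>poly q 0\<bar> \<le> C * integral {b<..} (\<lambda>x. \<bar>poly q (1 + x\<^sup>2 - b\<^sup>2)\<bar> * (g x / (1 + x\<^sup>2 - b\<^sup>2)))"
proof -
  let ?S = "{0<..<pi/2} :: real set"
  let ?X = "slit_param b"
  define D where "D = sqrt (1 + b\<^sup>2)"
  define M where "M = (\<lambda>\<psi>. max 0 (- ln (g (?X \<psi>))))"
  define N' where "N' = (\<lambda>\<psi>. M \<psi> - ln \<bar>sin \<psi>\<bar> + ln D)"
  define W where "W = (\<lambda>\<psi>. g (?X \<psi>) * tan \<psi> / ?X \<psi>)"
  have D: "D > 0" unfolding D_def by (simp add: add_pos_nonneg)
  have tan: "tan \<psi> > 0" and cos: "cos \<psi> > 0" and sin: "sin \<psi> > 0" and X: "?X \<psi> > b"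
    and sec: "1 + (?X \<psi>)\<^sup>2 - b\<^sup>2 = 1 / (cos \<psi>)\<^sup>2" "1 + (tan \<psi>)\<^sup>2 = 1 / (cos \<psi>)\<^sup>2"
    if "\<psi> \<in> ?S" for \<psi>
  proof -
    show 1: "tan \<psi> > 0" "cos \<psi> > 0" "sin \<psi> > 0" using that
      by (auto intro!: tan_gt_zero cos_gt_zero sin_gt_zero)
    show "?X \<psi> > b" by (rule slit_param_gt[OF b that])
    show "1 + (tan \<psi>)\<^sup>2 = 1 / (cos \<psi>)\<^sup>2"
      using tan_sec[of \<psi>] 1 by (simp add: field_simps)
    then show "1 + (?X \<psi>)\<^sup>2 - b\<^sup>2 = 1 / (cos \<psi>)\<^sup>2"
      using slit_param_square[of b \<psi>] by simp
  qed
  have "M integrable_on ?S"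
  proof -
    define F where "F = (\<lambda>x. max 0 (- ln (g x)) * (x / (sqrt (x\<^sup>2 - b\<^sup>2) * (1 + x\<^sup>2 - b\<^sup>2))))"
    have "(\<lambda>\<psi>. tan \<psi> * (1 + (tan \<psi>)\<^sup>2) / ?X \<psi> * F (?X \<psi>)) absolutely_integrable_on ?S"
      using iffD2[OF slit_change_of_variables[OF b, of F "integral {b<..} F"]] N
      unfolding F_def by fast
    then have "(\<lambda>\<psi>. tan \<psi> * (1 + (tan \<psi>)\<^sup>2) / ?X \<psi> * F (?X \<psi>)) integrable_on ?S"
      by (rule set_lebesgue_integral_eq_integral)
    then show ?thesis
    proof (rule integrable_eq)
      fix \<psi> assume S: "\<psi> \<in> ?S"
      have "?X \<psi> > 0" using X[OF S] b by simp
      then show "tan \<psi> * (1 + (tan \<psi>)\<^sup>2) / ?X \<psi> * F (?X \<psi>) = M \<psi>"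
        unfolding M_def F_def sec[OF S] slit_param_square using tan[OF S] cos[OF S] by simp
    qed
  qed
  then have N': "N' integrable_on {0..pi/2}"
    unfolding N'_def
    using ln_abs_sin_integrable_quarter integrable_const_ivl[of "ln D" 0 "pi/2"]
    by (intro integrable_add integrable_diff) (auto simp: integrable_on_Icc_iff_Ioo)
  have pos: "W \<psi> > 0" if "\<psi> \<in> ?S" for \<psi>
    unfolding W_def using g[OF X[OF that]] tan[OF that] X[OF that] b by simp
  have le: "- ln (W \<psi>) \<le> N' \<psi>" if S: "\<psi> \<in> ?S" for \<psi>
  proof -
    have X0: "?X \<psi> > 0" using X[OF S] b by simp
    have "(?X \<psi> * cos \<psi>)\<^sup>2 = b\<^sup>2 * (cos \<psi>)\<^sup>2 + (sin \<psi>)\<^sup>2"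
      using cos[OF S] slit_param_square[of b \<psi>] by (simp add: tan_def field_simps)
    also have "\<dots> \<le> b\<^sup>2 * 1 + 1"
      by (intro add_mono mult_left_mono) (auto simp: abs_square_le_1)
    also have "\<dots> = D\<^sup>2" unfolding D_def by (simp add: add_nonneg_nonneg)
    finally have "?X \<psi> * cos \<psi> \<le> D" using D by (simp add: power2_le_iff_abs_le)
    then have "sin \<psi> / D \<le> sin \<psi> / (?X \<psi> * cos \<psi>)"
      using sin[OF S] cos[OF S] X0 D by (intro divide_left_mono) auto
    also have "\<dots> = tan \<psi> / ?X \<psi>" by (simp add: tan_def)
    finally have "ln (sin \<psi> / D) \<le> ln (tan \<psi> / ?X \<psi>)"
      using sin[OF S] D by (intro ln_mono) auto
    moreover have "ln (W \<psi>) = ln (g (?X \<psi>)) + ln (tan \<psi> / ?X \<psi>)"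
      unfolding W_def times_divide_eq_right[symmetric]
      using g[OF X[OF S]] tan[OF S] X0 by (intro ln_mult_pos) auto
    moreover have "ln (sin \<psi> / D) = ln (sin \<psi>) - ln D"
      using sin[OF S] D by (simp add: ln_div)
    ultimately show ?thesis unfolding N'_def M_def using sin[OF S] by simp
  qed
  define C where "C = exp (2/pi * integral {0..pi/2} N') * (2/pi)"
  show ?thesis
  proof (rule that[of C])
    show C: "0 < C" unfolding C_def by simp
    fix q :: "real poly"
    let ?f = "\<lambda>x. \<bar>poly q (1 + x\<^sup>2 - b\<^sup>2)\<bar> * (g x / (1 + x\<^sup>2 - b\<^sup>2))"
    assume f: "?f absolutely_integrable_on {b<..}"
    let ?h = "\<lambda>\<psi>. tan \<psi> * (1 + (tan \<psi>)\<^sup>2) / ?X \<psi> * ?f (?X \<psi>)"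
    let ?k = "\<lambda>\<psi>. \<bar>poly q (1 / (cos \<psi>)\<^sup>2)\<bar> * W \<psi>"
    have h: "?h absolutely_integrable_on ?S" "integral ?S ?h = integral {b<..} ?f"
      using slit_change_of_variables[OF b, of ?f "integral {b<..} ?f"] f by auto
    have hk: "?h \<psi> = ?k \<psi>" if S: "\<psi> \<in> ?S" for \<psi>
      unfolding W_def sec[OF S] using cos[OF S] by simp
    have k: "?k integrable_on {0..pi/2}"
      using set_lebesgue_integral_eq_integral(1)[OF h(1)] hk
      unfolding integrable_on_Icc_iff_Ioo by (rule integrable_eq)
    have "integral {0..pi/2} ?k = integral ?S ?k" by (simp add: integral_open_interval_real)
    also have "\<dots> = integral ?S ?h"
      by (intro Henstock_Kurzweil_Integration.integral_cong hk[symmetric])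
    finally have ik: "integral {0..pi/2} ?k = integral {b<..} ?f" unfolding h(2) .
    show "\<bar>poly q 0\<bar> \<le> C * integral {b<..} ?f"
    proof (cases "poly q 0 = 0")
      case True
      have "0 \<le> integral {b<..} ?f"
      proof (rule Henstock_Kurzweil_Integration.integral_nonneg)
        fix x assume x: "x \<in> {b<..}"
        then have "x\<^sup>2 - b\<^sup>2 > 0" using b by (simp add: power_strict_mono)
        then show "0 \<le> ?f x" using g[of x] x by auto
      qed (rule set_lebesgue_integral_eq_integral(1)[OF f])
      with True C show ?thesis by simp
    next
      case False
      from polynomial_value_bound_jensen[OF this N' k pos le] show ?thesis
        unfolding ik C_def .
    qed
  qed
qed

section \<open>Choice of the end point of the half-line\<close>

lemma nn_integral_inverse_sqrt_unit:
  "(\<integral>\<^sup>+y. ennreal (indicator {0..1} y * y powr (- 1 / 2)) \<partial>lborel) = 2"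
proof -
  have "((\<lambda>y::real. y powr (- 1 / 2)) has_integral 2) {0..1}"
    using has_integral_powr_from_0[of "- 1 / 2" 1] by simp
  from nn_integral_has_integral_lebesgue[OF _ this] show ?thesis by simp
qed

text \<open>
  Away from the end point the kernel behaves like \<open>1 / (1 + x\<^sup>2)\<close>, and at the end point like
  \<open>1 / sqrt (x - b)\<close>, with constants that are uniform in \<open>b\<close>. The factor containing \<open>x - b\<close> is integrable in
  \<open>b\<close> over \<open>(c, c + 1)\<close>, uniformly in \<open>x\<close>.
\<close>

lemma slit_kernel_bound:
  fixes b c x :: real
  assumes "0 \<le> c" "c < b" "b < c + 1" "b < x"
  shows "x / (sqrt (x\<^sup>2 - b\<^sup>2) * (1 + x\<^sup>2 - b\<^sup>2))
    \<le> (1 + (c + 1)\<^sup>2) * (1 + sqrt (c + 1)) * (1 + indicator {0..1} (x - b) * (x - b) powr (- 1 / 2)) / (1 + x\<^sup>2)"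
proof -
  let ?p = "indicator {0..1} (x - b) * (x - b) powr (- 1 / 2) :: real"
  have p0: "0 \<le> ?p" by simp
  have b: "0 < b" using assms by simp
  have pos: "0 < x\<^sup>2 - b\<^sup>2" using assms b by (simp add: power_strict_mono)
  \<comment> \<open>The singular term is kept on the unit interval only, where it is integrable.\<close>
  have "1 / sqrt (x - b) \<le> 1 + ?p"
  proof (cases "x - b \<le> 1")
    case True
    have "(x - b) powr (- (1 / 2)) = 1 / sqrt (x - b)"
      using assms by (simp only: powr_minus_divide powr_half_sqrt)
    then show ?thesis using True assms by simp
  next
    case False
    then have "1 \<le> sqrt (x - b)" by simp
    then have "1 / sqrt (x - b) \<le> 1" by simp
    also have "1 \<le> 1 + ?p" by simp
    finally show ?thesis .
  qed
  then have 1: "1 + sqrt (c + 1) * (1 / sqrt (x - b)) \<le> 1 + sqrt (c + 1) * (1 + ?p)"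
    using assms by (intro add_left_mono mult_left_mono) auto
  have "x / sqrt (x\<^sup>2 - b\<^sup>2) \<le> 1 + sqrt (c + 1) * (1 / sqrt (x - b))"
  proof -
    have "x\<^sup>2 * (x - b) \<le> (x + (c + 1 - b)) * (x\<^sup>2 - b\<^sup>2)"
    proof -
      have "x\<^sup>2 * (x - b) \<le> x * (x\<^sup>2 - b\<^sup>2)"
      proof -
        have "x * (x - b) * x \<le> x * (x - b) * (x + b)"
          using assms b by (intro mult_left_mono) auto
        then show ?thesis by (simp add: power2_eq_square algebra_simps)
      qed
      also have "\<dots> \<le> (x + (c + 1 - b)) * (x\<^sup>2 - b\<^sup>2)"
        using assms pos by (intro mult_right_mono) auto
      finally show ?thesis .
    qed
    then have "x\<^sup>2 / (x\<^sup>2 - b\<^sup>2) \<le> 1 + (c + 1) / (x - b)"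
      using pos assms by (simp add: field_simps)
    then have "sqrt (x\<^sup>2 / (x\<^sup>2 - b\<^sup>2)) \<le> sqrt (1 + (c + 1) / (x - b))" by simp
    also have "\<dots> \<le> sqrt 1 + sqrt ((c + 1) / (x - b))"
      using assms by (intro sqrt_add_le_add_sqrt) auto
    finally show ?thesis using assms b by (simp add: real_sqrt_divide)
  qed
  also note 1
  also have "1 + sqrt (c + 1) * (1 + ?p) \<le> (1 + sqrt (c + 1)) * (1 + ?p)"
    using p0 by (simp add: algebra_simps)
  finally have A: "x / sqrt (x\<^sup>2 - b\<^sup>2) \<le> (1 + sqrt (c + 1)) * (1 + ?p)" .
  have B: "1 / (1 + x\<^sup>2 - b\<^sup>2) \<le> (1 + (c + 1)\<^sup>2) / (1 + x\<^sup>2)"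
  proof -
    have "1 + x\<^sup>2 \<le> (1 + b\<^sup>2) * (1 + x\<^sup>2 - b\<^sup>2)"
      using mult_nonneg_nonneg[of "b\<^sup>2" "x\<^sup>2 - b\<^sup>2"] pos by (simp add: algebra_simps)
    also have "\<dots> \<le> (1 + (c + 1)\<^sup>2) * (1 + x\<^sup>2 - b\<^sup>2)"
      using assms b pos by (intro mult_right_mono add_left_mono power_mono) auto
    finally show ?thesis using pos by (simp add: field_simps add_pos_nonneg)
  qed
  have "x / (sqrt (x\<^sup>2 - b\<^sup>2) * (1 + x\<^sup>2 - b\<^sup>2)) = x / sqrt (x\<^sup>2 - b\<^sup>2) * (1 / (1 + x\<^sup>2 - b\<^sup>2))"
    by simp
  also have "\<dots> \<le> ((1 + sqrt (c + 1)) * (1 + ?p)) * ((1 + (c + 1)\<^sup>2) / (1 + x\<^sup>2))"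
    using A B pos p0 assms by (intro mult_mono) auto
  finally show ?thesis by (simp add: mult_ac)
qed

lemma set_integrable_lborel_imp_lebesgue:
  fixes h :: "real \<Rightarrow> real"
  assumes "h \<in> borel_measurable borel" "A \<in> sets borel" "integrable lborel (\<lambda>x. indicator A x * h x)"
  shows "h absolutely_integrable_on A" "integral A h = (\<integral>x. indicator A x * h x \<partial>lborel)"
proof -
  have m: "(\<lambda>x. indicator A x *\<^sub>R h x) \<in> borel_measurable lborel" using assms by auto
  show 1: "h absolutely_integrable_on A"
    unfolding set_integrable_def using assms(3) integrable_completion[OF m] by simp
  show "integral A h = (\<integral>x. indicator A x * h x \<partial>lborel)"
    using set_lebesgue_integral_eq_integral(2)[OF 1] integral_completion[OF m]
    by (simp add: set_lebesgue_integral_def)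
qed

text \<open>
  Integrate the bound on the kernel first over \<open>b\<close> and then over \<open>x\<close>: the double integral is
  finite, so the inner integral over \<open>x\<close> is finite for almost every \<open>b\<close>.
\<close>

lemma exists_slit_endpoint:
  fixes N :: "real \<Rightarrow> real"
  assumes c: "0 \<le> c" and N [measurable]: "N \<in> borel_measurable borel" and N0: "\<And>x. 0 \<le> N x"
    and fin: "(\<integral>\<^sup>+x. ennreal (N x / (1 + x\<^sup>2)) * indicator {c<..} x \<partial>lborel) < \<infinity>"
  obtains b where "c < b" "b < c + 1"
    "(\<lambda>x. N x * (x / (sqrt (x\<^sup>2 - b\<^sup>2) * (1 + x\<^sup>2 - b\<^sup>2)))) absolutely_integrable_on {b<..}"
proof -
  define p :: "real \<Rightarrow> real" where "p y = indicator {0..1} y * y powr (- 1 / 2)" for y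
  have [measurable]: "p \<in> borel_measurable borel" unfolding p_def by measurable
  have p0: "0 \<le> p y" for y by (simp add: p_def)
  define A where "A = (1 + (c + 1)\<^sup>2) * (1 + sqrt (c + 1))"
  have A: "0 \<le> A" using c by (simp add: A_def)
  define D where "D x b = ennreal (N x / (1 + x\<^sup>2)) * indicator {c<..} x * (ennreal A * (1 + ennreal (p (x - b))))" for x b
  have [measurable]: "(\<lambda>(x, b). D x b) \<in> borel_measurable (borel \<Otimes>\<^sub>M borel)"
    unfolding D_def by measurable
  have [measurable]: "(\<lambda>(x, b). D x b) \<in> borel_measurable (lborel \<Otimes>\<^sub>M lborel)"
    by measurable
  have inner: "(\<integral>\<^sup>+b. D x b * indicator {c<..<c + 1} b \<partial>lborel)
      \<le> ennreal (N x / (1 + x\<^sup>2)) * indicator {c<..} x * (ennreal A * 3)" for x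
  proof -
    have "(\<integral>\<^sup>+b. ennreal (p (x - b)) \<partial>lborel) = (\<integral>\<^sup>+y. ennreal (p y) \<partial>lborel)"
      using nn_integral_real_affine[of "\<lambda>y. ennreal (p y)" "-1" x] by simp
    also have "\<dots> = 2" using nn_integral_inverse_sqrt_unit by (simp add: p_def)
    finally have P: "(\<integral>\<^sup>+b. ennreal (p (x - b)) \<partial>lborel) = 2" .
    have "(\<integral>\<^sup>+b. (1 + ennreal (p (x - b))) * indicator {c<..<c + 1} b \<partial>lborel)
        \<le> (\<integral>\<^sup>+b. indicator {c<..<c + 1} b + ennreal (p (x - b)) \<partial>lborel)"
      by (intro nn_integral_mono) (auto simp: indicator_def)
    also have "\<dots> = 1 + 2" using P by (subst nn_integral_add) auto
    finally have "(\<integral>\<^sup>+b. (1 + ennreal (p (x - b))) * indicator {c<..<c + 1} b \<partial>lborel) \<le> 3" by simp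
    moreover have "(\<integral>\<^sup>+b. D x b * indicator {c<..<c + 1} b \<partial>lborel)
      = ennreal (N x / (1 + x\<^sup>2)) * indicator {c<..} x * ennreal A *
        (\<integral>\<^sup>+b. (1 + ennreal (p (x - b))) * indicator {c<..<c + 1} b \<partial>lborel)"
      unfolding D_def by (subst nn_integral_cmult[symmetric]) (auto simp: mult.assoc)
    ultimately show ?thesis by (simp add: mult.assoc mult_left_mono)
  qed
  have "(\<integral>\<^sup>+b. (\<integral>\<^sup>+x. D x b * indicator {c<..<c + 1} b \<partial>lborel) \<partial>lborel)
      = (\<integral>\<^sup>+x. (\<integral>\<^sup>+b. D x b * indicator {c<..<c + 1} b \<partial>lborel) \<partial>lborel)"
    by (rule lborel_pair.Fubini') measurable
  also have "\<dots> \<le> (\<integral>\<^sup>+x. ennreal (N x / (1 + x\<^sup>2)) * indicator {c<..} x * (ennreal A * 3) \<partial>lborel)"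
    by (intro nn_integral_mono inner)
  also have "\<dots> = (\<integral>\<^sup>+x. ennreal (N x / (1 + x\<^sup>2)) * indicator {c<..} x \<partial>lborel) * (ennreal A * 3)"
    by (rule nn_integral_multc) measurable
  also have "\<dots> < \<infinity>" using fin by (simp add: ennreal_mult_less_top)
  finally have "(\<integral>\<^sup>+b. (\<integral>\<^sup>+x. D x b * indicator {c<..<c + 1} b \<partial>lborel) \<partial>lborel) \<noteq> \<infinity>" by simp
  then have ae: "AE b in lborel. (\<integral>\<^sup>+x. D x b * indicator {c<..<c + 1} b \<partial>lborel) \<noteq> \<infinity>"
    by (intro nn_integral_PInf_AE) measurable
  have "\<exists>b\<in>{c<..<c + 1}. (\<integral>\<^sup>+x. D x b \<partial>lborel) \<noteq> \<infinity>"
  proof (rule ccontr)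
    assume "\<not> ?thesis"
    then have none: "(\<integral>\<^sup>+x. D x b \<partial>lborel) = \<infinity>" if "b \<in> {c<..<c + 1}" for b using that by blast
    have "AE b in lborel. b \<notin> {c<..<c + 1}"
      using ae
    proof eventually_elim
      case (elim b)
      then show ?case using none[of b] by (cases "b \<in> {c<..<c + 1}") simp_all
    qed
    then have "{c<..<c + 1} \<in> null_sets lborel"
      using AE_iff_null_sets[of "{c<..<c + 1}" lborel] by simp
    then show False by (simp add: null_sets_def)
  qed
  then obtain b where b: "c < b" "b < c + 1" "(\<integral>\<^sup>+x. D x b \<partial>lborel) < \<infinity>"
    by (auto simp: less_top)
  let ?h = "\<lambda>x. N x * (x / (sqrt (x\<^sup>2 - b\<^sup>2) * (1 + x\<^sup>2 - b\<^sup>2)))"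
  have "integrable lborel (\<lambda>x. indicator {b<..} x * ?h x)"
  proof (rule integrableI_bounded)
    have "(\<integral>\<^sup>+x. ennreal (norm (indicator {b<..} x * ?h x)) \<partial>lborel) \<le> (\<integral>\<^sup>+x. D x b \<partial>lborel)"
    proof (rule nn_integral_mono)
      fix x
      show "ennreal (norm (indicator {b<..} x * ?h x)) \<le> D x b"
      proof (cases "b < x")
        case True
        have pos: "0 < x\<^sup>2 - b\<^sup>2" using True b c by (simp add: power_strict_mono)
        have "?h x \<le> N x * (A * (1 + p (x - b)) / (1 + x\<^sup>2))"
          unfolding A_def p_def using slit_kernel_bound[OF c b(1,2) True] N0 by (intro mult_left_mono) auto
        then have "norm (indicator {b<..} x * ?h x) \<le> N x / (1 + x\<^sup>2) * (A * (1 + p (x - b)))"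
          using True N0 pos b c by (simp add: mult_ac)
        then have "ennreal (norm (indicator {b<..} x * ?h x)) \<le> ennreal (N x / (1 + x\<^sup>2) * (A * (1 + p (x - b))))"
          by (rule ennreal_leI)
        also have "\<dots> = D x b"
        proof -
          have "ennreal (u * (A * v)) = ennreal u * (ennreal A * ennreal v)" if "0 \<le> u" "0 \<le> v" for u v
            using that A by (simp add: ennreal_mult)
          from this[of "N x / (1 + x\<^sup>2)" "1 + p (x - b)"]
          have "ennreal (N x / (1 + x\<^sup>2) * (A * (1 + p (x - b))))
              = ennreal (N x / (1 + x\<^sup>2)) * (ennreal A * ennreal (1 + p (x - b)))"
            using N0[of x] p0[of "x - b"] by simp
          also have "ennreal (1 + p (x - b)) = 1 + ennreal (p (x - b))"
            using p0[of "x - b"] by (subst ennreal_plus) auto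
          finally show ?thesis unfolding D_def using True b by simp
        qed
        finally show ?thesis .
      qed simp
    qed
    also note b(3)
    finally show "(\<integral>\<^sup>+x. ennreal (norm (indicator {b<..} x * ?h x)) \<partial>lborel) < \<infinity>" .
  qed measurable
  then have "?h absolutely_integrable_on {b<..}"
    by (intro set_integrable_lborel_imp_lebesgue) auto
  with b show ?thesis by (intro that)
qed

section \<open>Extremal polynomials in mean\<close>

lemma integrable_poly:
  fixes \<mu> :: "real measure"
  assumes "\<And>k. integrable \<mu> (\<lambda>x. x ^ k)"
  shows "integrable \<mu> (poly p)"
  unfolding poly_altdef using assms by (intro Bochner_Integration.integrable_sum integrable_mult_right)

lemma borel_measurable_poly [measurable]: "poly (p :: real poly) \<in> borel_measurable borel"
  by (intro borel_measurable_continuous_onI continuous_on_poly continuous_on_id)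

lemma AE_poly_nonzero:
  fixes \<mu> :: "real measure"
  assumes "sets \<mu> = sets borel" "\<And>x. emeasure \<mu> {x} = 0" "p \<noteq> 0"
  shows "AE x in \<mu>. poly p x \<noteq> 0"
proof -
  have "(\<Union>z\<in>{x. poly p x = 0}. {z}) \<in> null_sets \<mu>"
    using assms poly_roots_finite[of p]
    by (intro null_sets_UN') (auto intro: countable_finite simp: null_sets_def)
  then show ?thesis by (auto dest: AE_not_in)
qed

text \<open>
  A bound on the value at \<open>0\<close> propagates to all coefficients, because the next coefficient is the
  value at \<open>0\<close> of \<open>(q x - q 0) / x\<close>, and division by \<open>x\<close> is harmless on \<open>[\<delta>, \<infinity>)\<close>. This yields
  the compactness needed for the extremal problem.
\<close>

lemma coeff_bound_of_value_bound:
  fixes \<mu> :: "real measure"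
  assumes fin: "finite_measure \<mu>"
    and int: "\<And>k. integrable \<mu> (\<lambda>x. x ^ k)"
    and \<delta>: "0 < \<delta>" "AE x in \<mu>. \<delta> \<le> x"
    and bound: "\<And>q. \<bar>poly q 0\<bar> \<le> C * (\<integral>x. \<bar>poly q x\<bar> \<partial>\<mu>)"
  shows "\<exists>D. \<forall>q. \<bar>coeff q k\<bar> \<le> D * (\<integral>x. \<bar>poly q x\<bar> \<partial>\<mu>)"
proof (induction k)
  case 0
  show ?case using bound by (auto simp: poly_0_coeff_0)
next
  case (Suc k)
  interpret finite_measure \<mu> by (rule fin)
  note [intro] = integrable_poly[OF int]
  obtain D where D: "\<And>q. \<bar>coeff q k\<bar> \<le> D * (\<integral>x. \<bar>poly q x\<bar> \<partial>\<mu>)" using Suc by blast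
  let ?m = "measure \<mu> (space \<mu>)"
  have "\<bar>coeff q (Suc k)\<bar> \<le> \<bar>D\<bar> * ((1 + \<bar>C\<bar> * ?m) / \<delta>) * (\<integral>x. \<bar>poly q x\<bar> \<partial>\<mu>)" for q
  proof -
    obtain c r where q: "q = pCons c r" by (cases q)
    let ?J = "\<integral>x. \<bar>poly q x\<bar> \<partial>\<mu>"
    have J: "0 \<le> ?J" by (intro Bochner_Integration.integral_nonneg) auto
    have c: "\<bar>c\<bar> \<le> \<bar>C\<bar> * ?J"
      using bound[of q] mult_right_mono[OF abs_ge_self[of C] J] by (simp add: q)
    have i: "integrable \<mu> (\<lambda>x. (\<bar>poly q x\<bar> + \<bar>c\<bar>) / \<delta>)"
      by (intro integrable_divide_zero Bochner_Integration.integrable_add integrable_abs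
          integrable_poly[OF int] integrable_const)
    have "(\<integral>x. \<bar>poly r x\<bar> \<partial>\<mu>) \<le> (\<integral>x. (\<bar>poly q x\<bar> + \<bar>c\<bar>) / \<delta> \<partial>\<mu>)"
    proof (rule integral_mono_AE)
      show "AE x in \<mu>. \<bar>poly r x\<bar> \<le> (\<bar>poly q x\<bar> + \<bar>c\<bar>) / \<delta>"
        using \<delta>(2)
      proof eventually_elim
        case (elim x)
        have "\<delta> * \<bar>poly r x\<bar> \<le> \<bar>x * poly r x\<bar>"
          using elim \<delta>(1) by (simp add: abs_mult mult_right_mono)
        also have "\<dots> \<le> \<bar>poly q x\<bar> + \<bar>c\<bar>" by (simp add: q)
        finally show ?case using \<delta>(1) by (simp add: field_simps)
      qed
    qed (use i in auto)
    also have "\<dots> = (?J + \<bar>c\<bar> * ?m) / \<delta>"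
      by (subst integral_divide_zero, subst Bochner_Integration.integral_add) (auto simp: mult.commute)
    also have "\<dots> \<le> (?J + \<bar>C\<bar> * ?J * ?m) / \<delta>"
      using c \<delta>(1) by (intro divide_right_mono add_left_mono mult_right_mono) auto
    also have "\<dots> = (1 + \<bar>C\<bar> * ?m) / \<delta> * ?J" by (simp add: algebra_simps)
    finally have r: "(\<integral>x. \<bar>poly r x\<bar> \<partial>\<mu>) \<le> (1 + \<bar>C\<bar> * ?m) / \<delta> * ?J" .
    have "\<bar>coeff q (Suc k)\<bar> \<le> D * (\<integral>x. \<bar>poly r x\<bar> \<partial>\<mu>)" using D[of r] by (simp add: q)
    also have "\<dots> \<le> \<bar>D\<bar> * (\<integral>x. \<bar>poly r x\<bar> \<partial>\<mu>)"
      by (intro mult_right_mono Bochner_Integration.integral_nonneg) auto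
    also have "\<dots> \<le> \<bar>D\<bar> * ((1 + \<bar>C\<bar> * ?m) / \<delta> * ?J)" using r by (intro mult_left_mono) auto
    finally show ?thesis by (simp add: mult.assoc)
  qed
  then show ?case by blast
qed

lemma continuous_on_integral_abs_poly:
  fixes \<mu> :: "real measure"
  assumes int: "\<And>k. integrable \<mu> (\<lambda>x. x ^ k)"
  shows "continuous_on UNIV (\<lambda>v :: nat \<Rightarrow> real. \<integral>x. \<bar>\<Sum>i\<le>n. v i * x ^ i\<bar> \<partial>\<mu>)"
    (is "continuous_on _ ?J")
proof (rule continuous_at_imp_continuous_on, rule ballI)
  fix u :: "nat \<Rightarrow> real"
  let ?B = "\<lambda>v :: nat \<Rightarrow> real. \<Sum>i\<le>n. \<bar>v i - u i\<bar> * (\<integral>x. \<bar>x ^ i\<bar> \<partial>\<mu>)"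
  have le: "norm (?J v - ?J u) \<le> ?B v" for v
  proof -
    have i: "integrable \<mu> (\<lambda>x. \<Sum>i\<le>n. w i * x ^ i)" for w :: "nat \<Rightarrow> real"
      using int by (intro Bochner_Integration.integrable_sum integrable_mult_right)
    have "norm (?J v - ?J u) = norm (\<integral>x. \<bar>\<Sum>i\<le>n. v i * x ^ i\<bar> - \<bar>\<Sum>i\<le>n. u i * x ^ i\<bar> \<partial>\<mu>)"
      using i by (subst Bochner_Integration.integral_diff) auto
    also have "\<dots> \<le> (\<integral>x. norm (\<bar>\<Sum>i\<le>n. v i * x ^ i\<bar> - \<bar>\<Sum>i\<le>n. u i * x ^ i\<bar>) \<partial>\<mu>)"
      by (rule integral_norm_bound)
    also have "\<dots> \<le> (\<integral>x. (\<Sum>i\<le>n. \<bar>v i - u i\<bar> * \<bar>x ^ i\<bar>) \<partial>\<mu>)"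
    proof (rule integral_mono)
      fix x
      have "norm (\<bar>\<Sum>i\<le>n. v i * x ^ i\<bar> - \<bar>\<Sum>i\<le>n. u i * x ^ i\<bar>)
          \<le> \<bar>(\<Sum>i\<le>n. v i * x ^ i) - (\<Sum>i\<le>n. u i * x ^ i)\<bar>" by simp
      also have "\<dots> = \<bar>\<Sum>i\<le>n. (v i - u i) * x ^ i\<bar>"
        by (simp add: sum_subtractf algebra_simps)
      also have "\<dots> \<le> (\<Sum>i\<le>n. \<bar>(v i - u i) * x ^ i\<bar>)" by (rule sum_abs)
      finally show "norm (\<bar>\<Sum>i\<le>n. v i * x ^ i\<bar> - \<bar>\<Sum>i\<le>n. u i * x ^ i\<bar>) \<le> (\<Sum>i\<le>n. \<bar>v i - u i\<bar> * \<bar>x ^ i\<bar>)"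
        by (simp add: abs_mult)
    next
      show "integrable \<mu> (\<lambda>x. norm (\<bar>\<Sum>i\<le>n. v i * x ^ i\<bar> - \<bar>\<Sum>i\<le>n. u i * x ^ i\<bar>))"
        by (intro integrable_norm Bochner_Integration.integrable_diff integrable_abs i)
      show "integrable \<mu> (\<lambda>x. \<Sum>i\<le>n. \<bar>v i - u i\<bar> * \<bar>x ^ i\<bar>)"
        by (intro Bochner_Integration.integrable_sum integrable_mult_right integrable_abs int)
    qed
    also have "\<dots> = ?B v"
      using int by (subst Bochner_Integration.integral_sum) (auto intro!: integrable_mult_right integrable_abs simp del: power_abs)
    finally show ?thesis .
  qed
  have "isCont (\<lambda>v :: nat \<Rightarrow> real. v i) u" for i
    using continuous_on_product_coordinates[of i] continuous_on_eq_continuous_at[OF open_UNIV] by blast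
  then have "isCont ?B u" by (intro continuous_intros)
  then have "(?B \<longlongrightarrow> 0) (at u)" by (auto dest: isContD)
  then have "((\<lambda>v. ?J v - ?J u) \<longlongrightarrow> 0) (at u)"
    by (rule Lim_null_comparison[rotated]) (use le in auto)
  then have "(?J \<longlongrightarrow> ?J u) (at u)" by (subst LIM_zero_iff[symmetric])
  then show "isCont ?J u" by (simp add: isCont_def)
qed

text \<open>
  Any competitor at least as good as the constant \<open>1\<close> has coefficients in a fixed product of
  compact intervals, so the minimum of a continuous function on a compact set is a global one.
\<close>

lemma L1_minimal_polynomial_exists:
  fixes \<mu> :: "real measure"
  assumes fin: "finite_measure \<mu>"
    and int: "\<And>k. integrable \<mu> (\<lambda>x. x ^ k)"
    and \<delta>: "0 < \<delta>" "AE x in \<mu>. \<delta> \<le> x"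
    and bound: "\<And>q. \<bar>poly q 0\<bar> \<le> C * (\<integral>x. \<bar>poly q x\<bar> \<partial>\<mu>)"
  obtains p :: "real poly" where "degree p \<le> n" "poly p 0 = 1"
    "\<And>q. degree q \<le> n \<Longrightarrow> poly q 0 = 1 \<Longrightarrow> (\<integral>x. \<bar>poly p x\<bar> \<partial>\<mu>) \<le> (\<integral>x. \<bar>poly q x\<bar> \<partial>\<mu>)"
proof -
  let ?J = "\<lambda>q. \<integral>x. \<bar>poly q x\<bar> \<partial>\<mu>"
  have J0: "0 \<le> ?J q" for q by (intro Bochner_Integration.integral_nonneg) auto
  obtain D where D: "\<And>k q. \<bar>coeff q k\<bar> \<le> D k * ?J q"
    using coeff_bound_of_value_bound[OF assms] by metis
  define A :: "nat \<Rightarrow> real set" where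
    "A i = (if i = 0 then {1} else if i \<le> n then {- (\<bar>D i\<bar> * ?J 1)..\<bar>D i\<bar> * ?J 1} else {0})" for i
  define P :: "(nat \<Rightarrow> real) \<Rightarrow> real poly" where "P v = (\<Sum>i\<le>n. monom (v i) i)" for v
  have polyP: "poly (P v) x = (\<Sum>i\<le>n. v i * x ^ i)" for v x
    by (simp add: P_def poly_sum poly_monom)
  have "compactin (product_topology (\<lambda>i. euclidean) UNIV) (PiE UNIV A)"
    unfolding compactin_PiE by (auto simp: A_def)
  then have comp: "compact (PiE UNIV A)" by (simp add: euclidean_product_topology)
  have "(\<lambda>i. if i = 0 then 1 else 0) \<in> PiE UNIV A"
    using J0[of 1] by (auto simp: A_def PiE_UNIV_domain)
  then have ne: "PiE UNIV A \<noteq> {}" by blast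
  have "continuous_on (PiE UNIV A) (\<lambda>v. ?J (P v))"
    unfolding polyP using continuous_on_integral_abs_poly[OF int] continuous_on_subset by blast
  from continuous_attains_inf[OF comp ne this]
  obtain v where v: "v \<in> PiE UNIV A" and min: "\<And>w. w \<in> PiE UNIV A \<Longrightarrow> ?J (P v) \<le> ?J (P w)"
    by blast
  have PA: "P (coeff q) = q" if "degree q \<le> n" for q
    using that by (intro poly_eqI) (auto simp: P_def coeff_sum coeff_eq_0)
  have inA: "coeff q \<in> PiE UNIV A" if "degree q \<le> n" "poly q 0 = 1" "?J q \<le> ?J 1" for q
  proof -
    have "\<bar>coeff q i\<bar> \<le> \<bar>D i\<bar> * ?J 1" for i
    proof -
      have "\<bar>coeff q i\<bar> \<le> D i * ?J q" by (rule D)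
      also have "\<dots> \<le> \<bar>D i\<bar> * ?J 1" using J0 that(3) by (intro mult_mono) auto
      finally show ?thesis .
    qed
    then have "coeff q i \<in> {- (\<bar>D i\<bar> * ?J 1)..\<bar>D i\<bar> * ?J 1}" for i
      unfolding atLeastAtMost_iff by (metis abs_le_D1 abs_le_D2 minus_le_iff)
    then have "coeff q i \<in> A i" for i
      using that by (auto simp: A_def poly_0_coeff_0 coeff_eq_0)
    then show ?thesis by (auto simp: PiE_UNIV_domain)
  qed
  show ?thesis
  proof (rule that[of "P v"])
    show "degree (P v) \<le> n"
      unfolding P_def by (intro degree_sum_le) (auto intro: order_trans[OF degree_monom_le])
    have "v 0 \<in> A 0" using v by (auto simp: PiE_UNIV_domain)
    then show "poly (P v) 0 = 1" by (simp add: polyP A_def power_0_left if_distrib sum.delta cong: if_cong)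
    fix q :: "real poly" assume q: "degree q \<le> n" "poly q 0 = 1"
    have "?J (P v) \<le> ?J 1" using min[OF inA[of 1]] PA[of 1] by simp
    then show "?J (P v) \<le> ?J q"
      using min[OF inA[OF q]] PA[OF q(1)] by (cases "?J q \<le> ?J 1") auto
  qed
qed

text \<open>
  The derivative of the norm of \<open>p + s * r\<close> at \<open>s = 0\<close>. It exists because \<open>p\<close> vanishes only on a
  null set, and only non-negativity of the right-hand difference quotients is needed, since \<open>r\<close> and
  \<open>- r\<close> are both admissible.
\<close>

lemma L1_minimal_polynomial_orthogonal:
  fixes \<mu> :: "real measure" and p r :: "real poly"
  assumes sets: "sets \<mu> = sets borel" and noatom: "\<And>x. emeasure \<mu> {x} = 0"
    and int: "\<And>k. integrable \<mu> (\<lambda>x. x ^ k)"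
    and p: "degree p \<le> n" "poly p 0 = 1"
    and min: "\<And>q. degree q \<le> n \<Longrightarrow> poly q 0 = 1 \<Longrightarrow> (\<integral>x. \<bar>poly p x\<bar> \<partial>\<mu>) \<le> (\<integral>x. \<bar>poly q x\<bar> \<partial>\<mu>)"
    and r: "degree r \<le> n" "poly r 0 = 0"
  shows "(\<integral>x. poly r x * sgn (poly p x) \<partial>\<mu>) = 0"
proof -
  note [measurable_cong] = sets
  note ip = integrable_poly[OF int]
  have nonneg: "0 \<le> (\<integral>x. poly r x * sgn (poly p x) \<partial>\<mu>)" if r: "degree r \<le> n" "poly r 0 = 0" for r
  proof -
    \<comment> \<open>The difference quotients of the norm at the steps \<open>1 / (j + 1)\<close>.\<close>
    let ?s = "\<lambda>j x. (\<bar>poly p x + inverse (Suc j) * poly r x\<bar> - \<bar>poly p x\<bar>) * Suc j"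
    have lim: "(\<lambda>j. \<integral>x. ?s j x \<partial>\<mu>) \<longlonglongrightarrow> (\<integral>x. poly r x * sgn (poly p x) \<partial>\<mu>)"
    proof (rule integral_dominated_convergence[where w = "\<lambda>x. \<bar>poly r x\<bar>"])
      show "integrable \<mu> (\<lambda>x. \<bar>poly r x\<bar>)" by (intro integrable_abs ip)
      show "AE x in \<mu>. norm (?s j x) \<le> \<bar>poly r x\<bar>" for j
      proof (rule AE_I2)
        fix x
        have "\<bar>\<bar>poly p x + inverse (Suc j) * poly r x\<bar> - \<bar>poly p x\<bar>\<bar> \<le> inverse (Suc j) * \<bar>poly r x\<bar>"
          by (rule order_trans[OF abs_triangle_ineq3]) (simp add: abs_mult)
        then have "\<bar>\<bar>poly p x + inverse (Suc j) * poly r x\<bar> - \<bar>poly p x\<bar>\<bar> * Suc j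
            \<le> inverse (Suc j) * \<bar>poly r x\<bar> * Suc j"
          by (rule mult_right_mono) simp
        also have "\<dots> = \<bar>poly r x\<bar>" by (simp del: of_nat_Suc)
        finally show "norm (?s j x) \<le> \<bar>poly r x\<bar>"
          by (simp only: real_norm_def abs_mult abs_of_nat)
      qed
      have "p \<noteq> 0" using p by auto
      from AE_poly_nonzero[OF sets noatom this]
      show "AE x in \<mu>. (\<lambda>j. ?s j x) \<longlonglongrightarrow> poly r x * sgn (poly p x)"
      proof eventually_elim
        case (elim x)
        have "(\<lambda>j. inverse (Suc j) * \<bar>poly r x\<bar>) \<longlonglongrightarrow> 0 * \<bar>poly r x\<bar>"
          by (intro tendsto_intros LIMSEQ_inverse_real_of_nat)
        then have "eventually (\<lambda>j. inverse (Suc j) * \<bar>poly r x\<bar> < \<bar>poly p x\<bar>) sequentially"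
          using elim by (intro order_tendstoD) auto
        then have "eventually (\<lambda>j. ?s j x = poly r x * sgn (poly p x)) sequentially"
        proof eventually_elim
          case (elim j)
          then have b: "\<bar>inverse (Suc j) * poly r x\<bar> < \<bar>poly p x\<bar>" by (simp add: abs_mult)
          have "\<bar>poly p x + inverse (Suc j) * poly r x\<bar> - \<bar>poly p x\<bar>
              = inverse (Suc j) * poly r x * sgn (poly p x)"
            using b by (cases "poly p x > 0") (auto simp: abs_if sgn_if split: if_splits)
          then show ?case by (simp add: field_simps)
        qed
        then show ?case by (rule tendsto_eventually)
      qed
    qed measurable
    have "0 \<le> (\<integral>x. ?s j x \<partial>\<mu>)" for j
    proof -
      define q where "q = p + smult (inverse (Suc j)) r"
      have q: "poly q x = poly p x + inverse (Suc j) * poly r x" for x by (simp add: q_def)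
      have "degree q \<le> n" unfolding q_def using p r by (intro degree_add_le order_trans[OF degree_smult_le]) auto
      moreover have "poly q 0 = 1" using p r by (simp add: q)
      ultimately have "(\<integral>x. \<bar>poly p x\<bar> \<partial>\<mu>) \<le> (\<integral>x. \<bar>poly q x\<bar> \<partial>\<mu>)" by (rule min)
      then have "0 \<le> (\<integral>x. \<bar>poly q x\<bar> - \<bar>poly p x\<bar> \<partial>\<mu>)"
        by (subst Bochner_Integration.integral_diff) (auto intro: ip)
      then have "0 \<le> (\<integral>x. (\<bar>poly q x\<bar> - \<bar>poly p x\<bar>) * Suc j \<partial>\<mu>)"
        by (subst integral_mult_left_zero) simp
      then show ?thesis unfolding q .
    qed
    then show ?thesis by (intro LIMSEQ_le_const[OF lim]) blast
  qed
  show ?thesis using nonneg[OF r] nonneg[of "- r"] r by simp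
qed

text \<open>
  The Hahn-Banach theorem in an explicit form: \<open>\<psi>\<close> is the sign of the extremal polynomial, and
  its integral equals the minimal norm.
\<close>

lemma annihilating_sign_function:
  fixes \<mu> :: "real measure"
  assumes fin: "finite_measure \<mu>" and sets: "sets \<mu> = sets borel"
    and noatom: "\<And>x. emeasure \<mu> {x} = 0"
    and int: "\<And>k. integrable \<mu> (\<lambda>x. x ^ k)"
    and \<delta>: "0 < \<delta>" "AE x in \<mu>. \<delta> \<le> x"
    and C: "0 < C"
    and bound: "\<And>q. \<bar>poly q 0\<bar> \<le> C * (\<integral>x. \<bar>poly q x\<bar> \<partial>\<mu>)"
  obtains \<psi> :: "real \<Rightarrow> real" where "\<psi> \<in> borel_measurable borel" "\<And>x. \<bar>\<psi> x\<bar> \<le> 1"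
    "\<And>r. degree r \<le> n \<Longrightarrow> poly r 0 = 0 \<Longrightarrow> (\<integral>x. poly r x * \<psi> x \<partial>\<mu>) = 0"
    "1 / C \<le> (\<integral>x. \<psi> x \<partial>\<mu>)"
proof -
  interpret finite_measure \<mu> by (rule fin)
  note [measurable_cong] = sets
  obtain p where p: "degree p \<le> n" "poly p 0 = 1"
    and min: "\<And>q. degree q \<le> n \<Longrightarrow> poly q 0 = 1 \<Longrightarrow> (\<integral>x. \<bar>poly p x\<bar> \<partial>\<mu>) \<le> (\<integral>x. \<bar>poly q x\<bar> \<partial>\<mu>)"
    using L1_minimal_polynomial_exists[OF fin int \<delta> bound] by metis
  have orth: "(\<integral>x. poly r x * sgn (poly p x) \<partial>\<mu>) = 0" if "degree r \<le> n" "poly r 0 = 0" for r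
    by (rule L1_minimal_polynomial_orthogonal[OF sets noatom int p _ that]) (rule min)
  show ?thesis
  proof (rule that[of "\<lambda>x. sgn (poly p x)"])
    show "(\<lambda>x. sgn (poly p x)) \<in> borel_measurable borel" by measurable
    show "\<bar>sgn (poly p x)\<bar> \<le> 1" for x by (simp add: sgn_if)
    show "(\<integral>x. poly r x * sgn (poly p x) \<partial>\<mu>) = 0" if "degree r \<le> n" "poly r 0 = 0" for r
      using that by (rule orth)
    have isgn: "integrable \<mu> (\<lambda>x. sgn (poly p x))"
      by (rule integrable_const_bound[where B = 1]) (auto simp: sgn_if)
    have ips: "integrable \<mu> (\<lambda>x. poly (p - 1) x * sgn (poly p x))"
      by (rule Bochner_Integration.integrable_bound[OF integrable_poly[OF int, of "p - 1"]]) (auto simp: sgn_if)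
    have "1 \<le> C * (\<integral>x. \<bar>poly p x\<bar> \<partial>\<mu>)" using bound[of p] p by simp
    also have "(\<integral>x. \<bar>poly p x\<bar> \<partial>\<mu>) = (\<integral>x. poly (p - 1) x * sgn (poly p x) + sgn (poly p x) \<partial>\<mu>)"
      by (intro Bochner_Integration.integral_cong) (auto simp: algebra_simps abs_sgn)
    also have "\<dots> = (\<integral>x. poly (p - 1) x * sgn (poly p x) \<partial>\<mu>) + (\<integral>x. sgn (poly p x) \<partial>\<mu>)"
      by (rule Bochner_Integration.integral_add[OF ips isgn])
    also have "(\<integral>x. poly (p - 1) x * sgn (poly p x) \<partial>\<mu>) = 0"
      using p by (intro orth degree_diff_le) auto
    finally show "1 / C \<le> (\<integral>x. sgn (poly p x) \<partial>\<mu>)" using C by (simp add: field_simps)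
  qed
qed

section \<open>From a bounded evaluation to a second measure\<close>

text \<open>
  The measures with densities \<open>\<phi> n\<close> relative to \<open>F\<close> are dominated by \<open>2 * F\<close>. This makes them
  tight, so that a subsequence converges weakly, and it makes the powers of \<open>x\<close> uniformly
  integrable, so that the moments pass to the limit. The bounded continuous function \<open>v\<close> separates
  the limit from \<open>F\<close>.
\<close>

lemma M_indet_of_perturbations:
  fixes \<phi> :: "nat \<Rightarrow> real \<Rightarrow> real" and v :: "real \<Rightarrow> real"
  assumes law: "stieltjes_law F"
    and meas [measurable]: "\<And>n. \<phi> n \<in> borel_measurable borel"
    and range: "\<And>n x. 0 \<le> \<phi> n x" "\<And>n x. \<phi> n x \<le> 2"
    and moments: "\<And>n k. k \<le> n \<Longrightarrow> (\<integral>x. \<phi> n x * x ^ k \<partial>F) = (\<integral>x. x ^ k \<partial>F)"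
    and v: "\<And>x. isCont v x" "\<And>x. \<bar>v x\<bar> \<le> B"
    and gap: "0 < \<eta>" "\<And>n. (\<integral>x. v x \<partial>F) + \<eta> \<le> (\<integral>x. \<phi> n x * v x \<partial>F)"
  shows "M_indet F"
proof -
  interpret F: prob_space F using law by (simp add: stieltjes_law_def)
  have sF [measurable_cong, simp]: "sets F = sets borel" and F0: "AE x in F. 0 \<le> x"
    and Fm1: "\<And>k. 1 \<le> k \<Longrightarrow> integrable F (\<lambda>x. x ^ k)"
    using law by (auto simp: stieltjes_law_def)
  have spF [simp]: "space F = UNIV" using sets_eq_imp_space_eq[OF sF] by simp
  have Fm: "integrable F (\<lambda>x. x ^ k)" for k
    using Fm1[of k] by (cases "k = 0") auto
  interpret Fr: real_distribution F by unfold_locales simp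
  define H where "H n = density F (\<lambda>x. ennreal (\<phi> n x))" for n
  have sH [measurable_cong, simp]: "sets (H n) = sets borel" for n by (simp add: H_def)
  have spH [simp]: "space (H n) = UNIV" for n by (simp add: H_def)
  have int_H: "integral\<^sup>L (H n) h = (\<integral>x. \<phi> n x * h x \<partial>F)"
    if "h \<in> borel_measurable borel" for n and h :: "real \<Rightarrow> real"
    unfolding H_def using that range by (subst integral_density) auto
  have integrable_phi: "integrable F (\<lambda>x. \<phi> n x * h x)" if "integrable F h" for n and h :: "real \<Rightarrow> real"
  proof (rule Bochner_Integration.integrable_bound[where f = "\<lambda>x. 2 * h x"])
    show "AE x in F. norm (\<phi> n x * h x) \<le> norm (2 * h x)"
      using range by (auto simp: abs_mult intro!: mult_right_mono)
  qed (use that in auto)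
  have AE_H: "AE x in H n. P x" if "AE x in F. P x" for P n
    unfolding H_def using that by (subst AE_density) (auto elim: AE_mp)
  have prob_H: "prob_space (H n)" for n
  proof
    have i: "integrable F (\<lambda>x. \<phi> n x)" using integrable_phi[of "\<lambda>_. 1"] by simp
    have "emeasure (H n) (space (H n)) = (\<integral>\<^sup>+x. ennreal (\<phi> n x) \<partial>F)"
      unfolding H_def by (subst emeasure_density) (auto intro!: nn_integral_cong)
    also have "\<dots> = ennreal (\<integral>x. \<phi> n x \<partial>F)"
      using i range by (intro nn_integral_eq_integral) auto
    also have "(\<integral>x. \<phi> n x \<partial>F) = 1" using moments[of 0 n] F.prob_space by simp
    finally show "emeasure (H n) (space (H n)) = 1" by simp
  qed
  have rd: "real_distribution (H n)" for n
  proof -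
    interpret prob_space "H n" by (rule prob_H)
    show ?thesis by unfold_locales simp
  qed
  have ind: "integrable F (indicator A :: real \<Rightarrow> real)" if "A \<in> sets borel" for A
    by (rule F.integrable_const_bound[where B = 1]) (use that in \<open>auto simp: indicator_def\<close>)
  have "tight H"
    unfolding tight_def
  proof (intro conjI allI impI rd)
    fix e :: real assume e: "0 < e"
    have "eventually (\<lambda>x. 1 - e / 2 < cdf F x \<and> -1 < x) at_top"
      using e by (intro eventually_conj order_tendstoD(1)[OF Fr.cdf_lim_at_top_prob] eventually_gt_at_top) auto
    then obtain b where b: "1 - e / 2 < cdf F b" "-1 < b"
      using eventually_happens'[OF trivial_limit_at_top_linorder] by blast
    have "1 - e < measure (H n) {-1<..b}" for n
    proof -
      interpret Hn: prob_space "H n" by (rule prob_H)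
      have "measure (H n) (- {-1<..b}) = (\<integral>x. \<phi> n x * indicator (- {-1<..b}) x \<partial>F)"
        using int_H[of "indicator (- {-1<..b})" n] by simp
      also have "\<dots> \<le> (\<integral>x. 2 * indicator {b<..} x \<partial>F)"
      proof (rule integral_mono_AE)
        show "AE x in F. \<phi> n x * indicator (- {-1<..b}) x \<le> 2 * indicator {b<..} x"
          using F0 by eventually_elim (use range in \<open>auto simp: indicator_def\<close>)
      qed (intro integrable_phi integrable_mult_right ind; simp)+
      also have "\<dots> = 2 * measure F {b<..}" by simp
      also have "measure F {b<..} = 1 - cdf F b"
        using F.prob_compl[of "{..b}"] by (simp add: cdf_def Compl_eq_Diff_UNIV[symmetric])
      finally have "measure (H n) (- {-1<..b}) < e" using b by simp
      then show ?thesis using Hn.prob_compl[of "{-1<..b}"] by (simp add: Compl_eq_Diff_UNIV)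
    qed
    then show "\<exists>a b. a < b \<and> (\<forall>n. 1 - e < measure (H n) {a<..b})" using b(2) by blast
  qed
  from tight_imp_convergent_subsubsequence[OF this strict_mono_id]
  obtain r L where r: "strict_mono r" and L: "real_distribution L" and conv: "weak_conv_m (H \<circ> r) L"
    by (auto simp: o_def)
  interpret L: real_distribution L by (rule L)
  have spL [simp]: "space L = UNIV" by (simp add: L.space_eq_univ)
  have lim: "(\<lambda>n. \<integral>x. \<phi> (r n) x * h x \<partial>F) \<longlonglongrightarrow> (\<integral>x. h x \<partial>L)"
    if h: "\<And>x. isCont h x" "\<And>x. \<bar>h x\<bar> \<le> b" for h :: "real \<Rightarrow> real" and b
  proof -
    have "h \<in> borel_measurable borel"
      using h by (intro borel_measurable_continuous_onI continuous_at_imp_continuous_on) auto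
    then show ?thesis
      using weak_conv_imp_integral_bdd_continuous_conv[OF _ L conv, of h b] rd h int_H by simp
  qed
  have L0: "AE x in L. 0 \<le> x"
  proof -
    \<comment> \<open>A bounded continuous function whose integral detects mass on the negative half-line.\<close>
    let ?h = "\<lambda>x::real. min 1 (max 0 (- x))"
    have [measurable]: "?h \<in> borel_measurable borel" by measurable
    have "(\<integral>x. \<phi> n x * ?h x \<partial>F) = 0" for n
      using F0 by (intro integral_eq_zero_AE) (auto elim!: eventually_mono)
    moreover have "(\<lambda>n. \<integral>x. \<phi> (r n) x * ?h x \<partial>F) \<longlonglongrightarrow> (\<integral>x. ?h x \<partial>L)"
      by (rule lim[of _ 1]) (auto intro!: continuous_intros)
    ultimately have 0: "(\<integral>x. ?h x \<partial>L) = 0" by (simp add: LIMSEQ_const_iff)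
    have "integrable L ?h" by (rule L.integrable_const_bound[where B = 1]) auto
    from integral_nonneg_eq_0_iff_AE[OF this] 0 have "AE x in L. ?h x = 0" by simp
    then show ?thesis by eventually_elim (auto simp: min_def max_def split: if_splits)
  qed
  have mL: "integrable L (\<lambda>x. x ^ k)" "(\<integral>x. x ^ k \<partial>L) = (\<integral>x. x ^ k \<partial>F)" if k: "1 \<le> k" for k
  proof -
    let ?m = "\<integral>x. x ^ k \<partial>F"
    \<comment> \<open>Truncations of \<open>x ^ k\<close> from above at height \<open>R\<close>, to which weak convergence applies; \<open>\<delta> R\<close> is the truncation error under \<open>F\<close>, and the domination by \<open>2 * F\<close> at most doubles it.\<close>
    define h where "h R x = min (real R) (max 0 x ^ k)" for R and x :: real
    have [measurable]: "h R \<in> borel_measurable borel" for R unfolding h_def by measurable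
    have h0: "0 \<le> h R x" "h R x \<le> real R" for R x unfolding h_def by auto
    have hx: "h R x \<le> x ^ k" if "0 \<le> x" for R x unfolding h_def using that by (simp add: max_def)
    have ihF: "integrable F (h R)" for R
      by (rule F.integrable_const_bound[where B = R]) (use h0 in auto)
    have ihL: "integrable L (h R)" for R
      by (rule L.integrable_const_bound[where B = R]) (use h0 in auto)
    define \<delta> where "\<delta> R = ?m - (\<integral>x. h R x \<partial>F)" for R
    have hlim: "(\<lambda>R. h R x) \<longlonglongrightarrow> x ^ k" if "0 \<le> x" for x
    proof (rule tendsto_eventually)
      show "eventually (\<lambda>R. h R x = x ^ k) sequentially"
        using eventually_ge_at_top[of "nat \<lceil>x ^ k\<rceil>"]
        by eventually_elim (use that in \<open>auto simp: h_def max_def min_def le_nat_iff ceiling_le_iff\<close>)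
    qed
    have "(\<lambda>R. \<integral>x. h R x \<partial>F) \<longlonglongrightarrow> ?m"
    proof (rule integral_dominated_convergence[where w = "\<lambda>x. x ^ k"])
      show "AE x in F. (\<lambda>R. h R x) \<longlonglongrightarrow> x ^ k" using F0 by eventually_elim (rule hlim)
      show "AE x in F. norm (h R x) \<le> x ^ k" for R
        using F0 by eventually_elim (use h0 hx in auto)
    qed (use Fm in auto)
    then have \<delta>: "(\<lambda>R. ?m - 2 * \<delta> R) \<longlonglongrightarrow> ?m - 2 * (?m - ?m)"
      unfolding \<delta>_def by (intro tendsto_intros)
    have b: "(\<integral>x. \<phi> n x * h R x \<partial>F) \<le> ?m" "?m - 2 * \<delta> R \<le> (\<integral>x. \<phi> n x * h R x \<partial>F)" if "k \<le> n" for n R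
    proof -
      have "(\<integral>x. \<phi> n x * h R x \<partial>F) \<le> (\<integral>x. \<phi> n x * x ^ k \<partial>F)"
      proof (rule integral_mono_AE)
        show "AE x in F. \<phi> n x * h R x \<le> \<phi> n x * x ^ k"
          using F0 by eventually_elim (use range hx in \<open>auto intro: mult_left_mono\<close>)
      qed (intro integrable_phi ihF Fm)+
      then show "(\<integral>x. \<phi> n x * h R x \<partial>F) \<le> ?m" using moments[OF that] by simp
      have "?m - (\<integral>x. \<phi> n x * h R x \<partial>F) = (\<integral>x. \<phi> n x * x ^ k - \<phi> n x * h R x \<partial>F)"
        using moments[OF that] by (subst Bochner_Integration.integral_diff) (auto intro: integrable_phi ihF Fm)
      also have "\<dots> \<le> (\<integral>x. 2 * (x ^ k - h R x) \<partial>F)"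
      proof (rule integral_mono_AE)
        show "AE x in F. \<phi> n x * x ^ k - \<phi> n x * h R x \<le> 2 * (x ^ k - h R x)"
          using F0
        proof eventually_elim
          case (elim x)
          have "\<phi> n x * (x ^ k - h R x) \<le> 2 * (x ^ k - h R x)"
            using range hx[OF elim] by (intro mult_right_mono) auto
          then show ?case by (simp add: algebra_simps)
        qed
      qed (intro Bochner_Integration.integrable_diff integrable_mult_right integrable_phi ihF Fm)+
      also have "\<dots> = 2 * \<delta> R"
        unfolding \<delta>_def using ihF Fm by (simp add: Bochner_Integration.integral_diff)
      finally show "?m - 2 * \<delta> R \<le> (\<integral>x. \<phi> n x * h R x \<partial>F)" by simp
    qed
    have l: "(\<lambda>n. \<integral>x. \<phi> (r n) x * h R x \<partial>F) \<longlonglongrightarrow> (\<integral>x. h R x \<partial>L)" for R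
      by (rule lim[of _ R]) (use h0 in \<open>auto simp: h_def intro!: continuous_intros\<close>)
    have rn: "k \<le> r n" if "k \<le> n" for n using seq_suble[OF r, of n] that by simp
    have u: "(\<integral>x. h R x \<partial>L) \<le> ?m" for R
      by (rule LIMSEQ_le_const2[OF l]) (use b(1) rn in blast)
    have lo: "?m - 2 * \<delta> R \<le> (\<integral>x. h R x \<partial>L)" for R
      by (rule LIMSEQ_le_const[OF l]) (use b(2) rn in blast)
    have ilim: "(\<lambda>R. \<integral>x. h R x \<partial>L) \<longlonglongrightarrow> ?m"
    proof (rule tendsto_sandwich)
      show "(\<lambda>R. ?m - 2 * \<delta> R) \<longlonglongrightarrow> ?m" using \<delta> by simp
    qed (use u lo in auto)
    have mono: "AE x in L. mono (\<lambda>R. h R x)" by (auto simp: mono_def h_def)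
    have plim: "AE x in L. (\<lambda>R. h R x) \<longlonglongrightarrow> x ^ k" using L0 by eventually_elim (rule hlim)
    have meas: "(\<lambda>x. x ^ k) \<in> borel_measurable L" by measurable
    show "integrable L (\<lambda>x. x ^ k)"
      by (rule integrable_monotone_convergence[OF ihL mono plim ilim meas])
    show "(\<integral>x. x ^ k \<partial>L) = ?m"
      by (rule integral_monotone_convergence[OF ihL mono plim ilim meas])
  qed
  have "stieltjes_law L"
    unfolding stieltjes_law_def using L0 mL(1) L.prob_space_axioms by simp
  moreover have "L \<noteq> F"
  proof
    assume "L = F"
    have "(\<integral>x. v x \<partial>F) + \<eta> \<le> (\<integral>x. v x \<partial>L)"
      by (rule LIMSEQ_le_const[OF lim[OF v]]) (use gap(2) in blast)
    with \<open>L = F\<close> gap(1) show False by simp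
  qed
  ultimately show ?thesis
    unfolding M_indet_def using law mL(2) by blast
qed

text \<open>
  The perturbation of \<open>F\<close> lives on \<open>t > a\<close>. The weight \<open>1 / (t - t0)\<close> is what converts the
  annihilator of the polynomials vanishing at \<open>t0\<close> into an annihilator of all polynomials: a
  polynomial \<open>r t\<close> is \<open>(t - t0) * r t\<close> times the weight.
\<close>

lemma M_indet_of_value_bound:
  fixes F :: "real measure"
  assumes law: "stieltjes_law F" and noatom: "\<And>x. emeasure F {x} = 0"
    and t: "t0 < a" and C: "0 < C"
    and bound: "\<And>q :: real poly.
      \<bar>poly q 0\<bar> \<le> C * (\<integral>t. indicator {a<..} t / (t - t0) * \<bar>poly q (t - t0)\<bar> \<partial>F)"
  shows "M_indet F"
proof -
  interpret F: prob_space F using law by (simp add: stieltjes_law_def)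
  have sF [measurable_cong, simp]: "sets F = sets borel"
    and Fm1: "\<And>k. 1 \<le> k \<Longrightarrow> integrable F (\<lambda>x. x ^ k)"
    using law by (auto simp: stieltjes_law_def)
  have spF [simp]: "space F = UNIV" using sets_eq_imp_space_eq[OF sF] by simp
  have Fm: "integrable F (\<lambda>x. x ^ k)" for k
    using Fm1[of k] by (cases "k = 0") auto
  define w :: "real \<Rightarrow> real" where "w t = indicator {a<..} t / (t - t0)" for t
  have [measurable]: "w \<in> borel_measurable borel" unfolding w_def by measurable
  have w0: "0 \<le> w x" for x using t by (auto simp: w_def indicator_def)
  have w1: "w x \<le> 1 / (a - t0)" for x
    using t by (auto simp: w_def indicator_def intro!: divide_left_mono)
  \<comment> \<open>Translated so that \<open>t0\<close> becomes the origin.\<close>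
  define \<mu> where "\<mu> = distr (density F (\<lambda>x. ennreal (w x))) borel (\<lambda>x. x - t0)"
  have s\<mu> [measurable_cong, simp]: "sets \<mu> = sets borel" by (simp add: \<mu>_def)
  have int_\<mu>: "integral\<^sup>L \<mu> h = (\<integral>x. w x * h (x - t0) \<partial>F)"
    if [measurable]: "h \<in> borel_measurable borel" for h :: "real \<Rightarrow> real"
    unfolding \<mu>_def using w0 by (simp add: integral_distr integral_density)
  have mom: "integrable \<mu> (\<lambda>x. x ^ k)" for k
  proof -
    have "integrable F (\<lambda>x. w x * (x - t0) ^ k)"
    proof (rule Bochner_Integration.integrable_bound)
      show "integrable F (\<lambda>x. 1 / (a - t0) * poly ([:- t0, 1:] ^ k) x)"
        by (intro integrable_mult_right integrable_poly Fm)
      show "AE x in F. norm (w x * (x - t0) ^ k) \<le> norm (1 / (a - t0) * poly ([:- t0, 1:] ^ k) x)"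
      proof (rule AE_I2)
        fix x
        have "w x * \<bar>x - t0\<bar> ^ k \<le> 1 / (a - t0) * \<bar>x - t0\<bar> ^ k"
          by (intro mult_right_mono w1) simp
        then show "norm (w x * (x - t0) ^ k) \<le> norm (1 / (a - t0) * poly ([:- t0, 1:] ^ k) x)"
          using w0[of x] t by (simp add: abs_mult power_abs poly_power)
      qed
    qed measurable
    then show ?thesis
      unfolding \<mu>_def using w0 by (simp add: integrable_distr_eq integrable_density)
  qed
  have fin: "finite_measure \<mu>"
  proof (rule finite_measureI)
    have "(\<integral>\<^sup>+x. ennreal (norm (x ^ 0 :: real)) \<partial>\<mu>) < \<infinity>"
      using mom[of 0] unfolding integrable_iff_bounded by blast
    then show "emeasure \<mu> (space \<mu>) \<noteq> \<infinity>" by simp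
  qed
  have noatom': "emeasure \<mu> {x} = 0" for x
  proof -
    have "(\<lambda>y. y - t0) -` {x} = {x + t0}" by auto
    then have "emeasure \<mu> {x} = (\<integral>\<^sup>+y\<in>{x + t0}. ennreal (w y) \<partial>F)"
      unfolding \<mu>_def by (simp add: emeasure_distr emeasure_density)
    also have "\<dots> = 0" using noatom by (intro nn_integral_null_set) (simp add: null_sets_def)
    finally show ?thesis .
  qed
  have pos: "AE x in \<mu>. a - t0 \<le> x"
    unfolding \<mu>_def by (subst AE_distr_iff) (auto simp: AE_density w_def indicator_def)
  have bound': "\<bar>poly q 0\<bar> \<le> C * (\<integral>x. \<bar>poly q x\<bar> \<partial>\<mu>)" for q
    using bound[of q] by (subst int_\<mu>) (auto simp: w_def)
  have "0 < a - t0" using t by simp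
  have "\<exists>\<psi> :: real \<Rightarrow> real. \<psi> \<in> borel_measurable borel \<and> (\<forall>x. \<bar>\<psi> x\<bar> \<le> 1) \<and>
      (\<forall>r. degree r \<le> Suc n \<longrightarrow> poly r 0 = 0 \<longrightarrow> (\<integral>x. poly r x * \<psi> x \<partial>\<mu>) = 0) \<and>
      1 / C \<le> (\<integral>x. \<psi> x \<partial>\<mu>)" for n
    by (rule annihilating_sign_function[OF fin s\<mu> noatom' mom \<open>0 < a - t0\<close> pos C bound', of "Suc n"]) blast
  then obtain \<psi> :: "nat \<Rightarrow> real \<Rightarrow> real" where
    \<psi>_meas [measurable]: "\<And>n. \<psi> n \<in> borel_measurable borel" and \<psi>1: "\<And>n x. \<bar>\<psi> n x\<bar> \<le> 1" and
    orth: "\<And>n r. degree r \<le> Suc n \<Longrightarrow> poly r 0 = 0 \<Longrightarrow> (\<integral>x. poly r x * \<psi> n x \<partial>\<mu>) = 0" and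
    gap: "\<And>n. 1 / C \<le> (\<integral>x. \<psi> n x \<partial>\<mu>)"
    by metis
  define \<phi> where "\<phi> n x = 1 + indicator {a<..} x * \<psi> n (x - t0)" for n x
  have split: "(\<integral>x. \<phi> n x * h x \<partial>F) = (\<integral>x. h x \<partial>F) + (\<integral>x. indicator {a<..} x * \<psi> n (x - t0) * h x \<partial>F)"
    if h: "integrable F h" for n and h :: "real \<Rightarrow> real"
  proof -
    have [measurable]: "h \<in> borel_measurable borel" using h by (simp add: borel_measurable_integrable flip: measurable_cong_sets[OF sF refl])
    have "integrable F (\<lambda>x. indicator {a<..} x * \<psi> n (x - t0) * h x)"
      by (rule Bochner_Integration.integrable_bound[OF h])
        (use \<psi>1 in \<open>auto simp: abs_mult indicator_def intro!: mult_left_le_one_le\<close>)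
    with h show ?thesis
      unfolding \<phi>_def by (simp add: distrib_right Bochner_Integration.integral_add)
  qed
  \<comment> \<open>A continuous extension of \<open>1 / (t - t0)\<close> to \<open>t \<le> a\<close>, where the perturbed measures agree with \<open>F\<close>.\<close>
  define v :: "real \<Rightarrow> real" where "v x = 1 / (max x a - t0)" for x
  have vpos: "max x a - t0 \<ge> a - t0" "max x a - t0 > 0" for x using t by auto
  have v1: "\<bar>v x\<bar> \<le> 1 / (a - t0)" for x
    using vpos[of x] t unfolding v_def by (auto intro!: divide_left_mono)
  have vcont: "isCont v x" for x
    unfolding v_def using vpos(2)[of x] by (intro continuous_intros) auto
  show ?thesis
  proof (rule M_indet_of_perturbations[OF law, of \<phi> v "1 / (a - t0)" "1 / C"])
    show "\<phi> n \<in> borel_measurable borel" for n unfolding \<phi>_def by measurable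
    show "0 \<le> \<phi> n x" "\<phi> n x \<le> 2" for n x
      using \<psi>1[of n "x - t0"] by (auto simp: \<phi>_def indicator_def)
    show "(\<integral>x. \<phi> n x * x ^ k \<partial>F) = (\<integral>x. x ^ k \<partial>F)" if k: "k \<le> n" for n k
    proof -
      \<comment> \<open>In the translated variable, \<open>(t - t0) * t ^ k\<close>; its degree \<open>k + 1\<close> explains the use of the annihilator of degree \<open>Suc n\<close>.\<close>
      define r :: "real poly" where "r = [:0, 1:] * [:t0, 1:] ^ k"
      have rx: "poly r x = x * (x + t0) ^ k" for x by (simp add: r_def poly_power add.commute)
      have "degree r \<le> degree [:0, 1 :: real:] + degree ([:t0, 1:] ^ k)"
        unfolding r_def by (rule degree_mult_le)
      also have "\<dots> \<le> Suc n" using k by (simp add: degree_linear_power)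
      finally have "(\<integral>x. poly r x * \<psi> n x \<partial>\<mu>) = 0" by (rule orth) (simp add: rx)
      also have "(\<integral>x. poly r x * \<psi> n x \<partial>\<mu>) = (\<integral>x. w x * (poly r (x - t0) * \<psi> n (x - t0)) \<partial>F)"
        by (rule int_\<mu>) measurable
      also have "\<dots> = (\<integral>x. indicator {a<..} x * \<psi> n (x - t0) * x ^ k \<partial>F)"
        using t by (intro Bochner_Integration.integral_cong) (auto simp: rx w_def indicator_def)
      finally show ?thesis using split[OF Fm] by simp
    qed
    show "isCont v x" "\<bar>v x\<bar> \<le> 1 / (a - t0)" for x by (rule vcont v1)+
    show "0 < 1 / C" using C by simp
    show "(\<integral>x. v x \<partial>F) + 1 / C \<le> (\<integral>x. \<phi> n x * v x \<partial>F)" for n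
    proof -
      have [measurable]: "v \<in> borel_measurable borel" unfolding v_def by measurable
      have iv: "integrable F v"
        by (rule F.integrable_const_bound[where B = "1 / (a - t0)"]) (use v1 in auto)
      have "1 / C \<le> (\<integral>x. w x * \<psi> n (x - t0) \<partial>F)" using gap[of n] by (simp add: int_\<mu>)
      also have "\<dots> = (\<integral>x. indicator {a<..} x * \<psi> n (x - t0) * v x \<partial>F)"
        by (intro Bochner_Integration.integral_cong) (auto simp: w_def v_def indicator_def)
      finally show ?thesis using split[OF iv] by simp
    qed
  qed
qed

section \<open>Krein's condition on the density of the square root\<close>

text \<open>
  As \<open>\<infinity> - \<infinity> = \<infinity>\<close> in the extended reals, a difference below \<open>\<infinity>\<close> forces the integral of the
  positive part to be finite.
\<close>

lemma log_integral_finiteD: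
  assumes "log_integral c g < \<infinity>" and [measurable]: "g \<in> borel_measurable borel"
  shows "(\<integral>\<^sup>+x\<in>{x. c \<le> \<bar>x\<bar>}. e2ennreal (log_integrand g x) \<partial>lborel) < \<infinity>"
    and "AE x in lborel. c \<le> \<bar>x\<bar> \<longrightarrow> g x \<noteq> 0"
proof -
  have [measurable]: "log_integrand g \<in> borel_measurable borel"
    unfolding log_integrand_def[abs_def] by measurable
  let ?I = "\<integral>\<^sup>+x\<in>{x. c \<le> \<bar>x\<bar>}. e2ennreal (log_integrand g x) \<partial>lborel"
  have ne: "?I \<noteq> \<infinity>"
  proof
    assume "?I = \<infinity>"
    then show False using assms(1) by (simp add: log_integral_def)
  qed
  then show "?I < \<infinity>" by (simp add: less_top)
  have "AE x in lborel. e2ennreal (log_integrand g x) * indicator {x. c \<le> \<bar>x\<bar>} x \<noteq> \<infinity>"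
    using ne by (intro nn_integral_PInf_AE) auto
  then show "AE x in lborel. c \<le> \<bar>x\<bar> \<longrightarrow> g x \<noteq> 0"
    by eventually_elim (auto simp: log_integrand_def)
qed

text \<open>
  The hypothesis \<open>square\<close> expresses that \<open>F\<close> is the law of the square of a random variable with
  density \<open>g\<close>; discarding \<open>y \<le> b\<close> only decreases the integrals of non-negative functions
  against \<open>g\<close>, so the bound on the value of a polynomial carries over to \<open>F\<close>.
\<close>

lemma M_indet_of_square_density:
  fixes F :: "real measure" and g :: "real \<Rightarrow> real"
  assumes law: "stieltjes_law F" and noatom: "\<And>x. emeasure F {x} = 0"
    and g [measurable]: "g \<in> borel_measurable borel" and g0: "\<And>x. 0 \<le> g x"
    and square: "\<And>h :: real \<Rightarrow> real. h \<in> borel_measurable borel \<Longrightarrow>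
      integrable F h \<Longrightarrow> integrable lborel (\<lambda>y. g y * h (y\<^sup>2)) \<and> (\<integral>t. h t \<partial>F) = (\<integral>y. g y * h (y\<^sup>2) \<partial>lborel)"
    and c: "0 \<le> c" and log: "log_integral c g < \<infinity>"
  shows "M_indet F"
proof -
  interpret F: prob_space F using law by (simp add: stieltjes_law_def)
  have sF [measurable_cong, simp]: "sets F = sets borel"
    and Fm1: "\<And>k. 1 \<le> k \<Longrightarrow> integrable F (\<lambda>x. x ^ k)"
    using law by (auto simp: stieltjes_law_def)
  have Fm: "integrable F (\<lambda>x. x ^ k)" for k
    using Fm1[of k] by (cases "k = 0") auto
  \<comment> \<open>The zeros of \<open>g\<close> beyond \<open>c\<close> form a null set, so \<open>g'\<close> is an everywhere positive weight with the same integrals over \<open>x > c\<close>.\<close>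
  define g' where "g' x = (if g x = 0 then 1 else g x)" for x
  have [measurable]: "g' \<in> borel_measurable borel" unfolding g'_def by measurable
  have g'pos: "0 < g' x" for x using g0[of x] by (simp add: g'_def less_le)
  define N where "N x = max 0 (- ln (g' x))" for x
  have [measurable]: "N \<in> borel_measurable borel" unfolding N_def by measurable
  have "(\<integral>\<^sup>+x. ennreal (N x / (1 + x\<^sup>2)) * indicator {c<..} x \<partial>lborel)
      \<le> (\<integral>\<^sup>+x\<in>{x. c \<le> \<bar>x\<bar>}. e2ennreal (log_integrand g x) \<partial>lborel)"
  proof (rule nn_integral_mono)
    fix x
    have "ennreal (N x / (1 + x\<^sup>2)) \<le> e2ennreal (log_integrand g x)"
    proof (cases "g x = 0")
      case False
      have "N x / (1 + x\<^sup>2) = max 0 (- ln (g x) / (1 + x\<^sup>2))"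
        using False by (simp add: N_def g'_def max_def field_simps add_pos_nonneg)
      then show ?thesis using False by (simp add: log_integrand_def e2ennreal_ereal ennreal_max_0)
    qed (simp add: N_def g'_def)
    then show "ennreal (N x / (1 + x\<^sup>2)) * indicator {c<..} x
        \<le> e2ennreal (log_integrand g x) * indicator {x. c \<le> \<bar>x\<bar>} x"
      using c by (auto simp: indicator_def)
  qed
  also have "\<dots> < \<infinity>" by (rule log_integral_finiteD(1)[OF log g])
  finally obtain b where b: "c < b" "b < c + 1"
    "(\<lambda>x. N x * (x / (sqrt (x\<^sup>2 - b\<^sup>2) * (1 + x\<^sup>2 - b\<^sup>2)))) absolutely_integrable_on {b<..}"
    using exists_slit_endpoint[OF c, of N] by (auto simp: N_def)
  have b0: "0 < b" using b c by simp
  obtain C where C: "0 < C" and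
    key: "\<And>q :: real poly. (\<lambda>x. \<bar>poly q (1 + x\<^sup>2 - b\<^sup>2)\<bar> * (g' x / (1 + x\<^sup>2 - b\<^sup>2))) absolutely_integrable_on {b<..} \<Longrightarrow>
      \<bar>poly q 0\<bar> \<le> C * integral {b<..} (\<lambda>x. \<bar>poly q (1 + x\<^sup>2 - b\<^sup>2)\<bar> * (g' x / (1 + x\<^sup>2 - b\<^sup>2)))"
    using polynomial_value_bound_of_log_integral[OF b0, of g'] g'pos b(3) unfolding N_def by blast
  let ?t = "b\<^sup>2 - 1"
  show ?thesis
  proof (rule M_indet_of_value_bound[OF law noatom _ C])
    show "?t < b\<^sup>2" by simp
    fix q :: "real poly"
    let ?h = "\<lambda>t. indicator {b\<^sup>2<..} t / (t - ?t) * \<bar>poly q (t - ?t)\<bar>"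
    let ?f = "\<lambda>x. \<bar>poly q (1 + x\<^sup>2 - b\<^sup>2)\<bar> * (g' x / (1 + x\<^sup>2 - b\<^sup>2))"
    have mh: "?h \<in> borel_measurable borel" by measurable
    have ih: "integrable F ?h"
    proof (rule Bochner_Integration.integrable_bound)
      show "integrable F (poly (pcompose q [:- ?t, 1:]))" by (rule integrable_poly[OF Fm])
      show "AE t in F. norm (?h t) \<le> norm (poly (pcompose q [:- ?t, 1:]) t)"
        by (rule AE_I2) (auto simp: poly_pcompose indicator_def abs_mult field_simps intro!: mult_right_mono)
    qed measurable
    note sq = square[OF mh ih]
    have ind: "indicator {b<..} x * (g x * ?h (x\<^sup>2)) = indicator {b<..} x *
        (\<bar>poly q (1 + x\<^sup>2 - b\<^sup>2)\<bar> * (g x / (1 + x\<^sup>2 - b\<^sup>2)))" for x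
      using b0 by (auto simp: indicator_def power_strict_mono algebra_simps)
    have iG: "integrable lborel (\<lambda>x. indicator {b<..} x * (g x * ?h (x\<^sup>2)))"
      using integrable_mult_indicator[of "{b<..}" lborel "\<lambda>x. g x * ?h (x\<^sup>2)"] sq by simp
    have ae: "AE x in lborel. indicator {b<..} x * (g x * ?h (x\<^sup>2)) = indicator {b<..} x * ?f x"
      using log_integral_finiteD(2)[OF log g]
    proof eventually_elim
      case (elim x)
      then show ?case unfolding ind using b(1) by (auto simp: g'_def indicator_def)
    qed
    have if': "integrable lborel (\<lambda>x. indicator {b<..} x * ?f x)"
      by (rule integrable_cong_AE_imp[OF iG]) (use ae in \<open>auto elim: eventually_mono\<close>)
    have mf: "?f \<in> borel_measurable borel" by measurable
    have mb: "{b<..} \<in> sets borel" by simp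
    note f = set_integrable_lborel_imp_lebesgue[OF mf mb if']
    have "\<bar>poly q 0\<bar> \<le> C * integral {b<..} ?f" by (rule key[OF f(1)])
    also have "integral {b<..} ?f = (\<integral>x. indicator {b<..} x * (g x * ?h (x\<^sup>2)) \<partial>lborel)"
      unfolding f(2) by (rule integral_cong_AE) (use ae in \<open>auto elim: eventually_mono\<close>)
    also have "\<dots> \<le> (\<integral>x. g x * ?h (x\<^sup>2) \<partial>lborel)"
    proof (rule integral_mono[OF iG conjunct1[OF sq]])
      fix x
      have "0 \<le> g x * ?h (x\<^sup>2)" using g0 by (auto simp: indicator_def)
      then show "indicator {b<..} x * (g x * ?h (x\<^sup>2)) \<le> g x * ?h (x\<^sup>2)"
        by (auto simp: indicator_def)
    qed
    also have "\<dots> = (\<integral>t. ?h t \<partial>F)" using sq by simp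
    finally show "\<bar>poly q 0\<bar> \<le> C * (\<integral>t. ?h t \<partial>F)" using C by simp
  qed
qed

theorem lemma4:
  fixes M :: "'a measure" and X \<epsilon> Y :: "'a \<Rightarrow> real" and f g :: "real \<Rightarrow> real" and c :: real
  assumes "prob_space M"
    and "AE \<omega> in M. 0 \<le> X \<omega>"
    and "\<And>x. 0 \<le> f x"
    and "distributed M lborel X (\<lambda>x. ennreal (f x))"
    and "\<And>k. 1 \<le> k \<Longrightarrow> integrable M (\<lambda>\<omega>. X \<omega> ^ k)"
    and "prob_space.indep_var M borel \<epsilon> borel X"
    and "measure M {\<omega> \<in> space M. \<epsilon> \<omega> = 1} = 1 / 2"
    and "measure M {\<omega> \<in> space M. \<epsilon> \<omega> = - 1} = 1 / 2"
    and "\<And>\<omega>. \<omega> \<in> space M \<Longrightarrow> Y \<omega> = \<epsilon> \<omega> * sqrt (X \<omega>)"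
    and "\<And>x. 0 \<le> g x"
    and "distributed M lborel Y (\<lambda>x. ennreal (g x))"
    and "0 \<le> c"
    and "log_integral c g < \<infinity>"
  shows "M_indet (distr M borel X)"
proof -
  interpret prob_space M by fact
  have X [measurable]: "X \<in> borel_measurable M" and Y [measurable]: "Y \<in> borel_measurable M"
    using assms(4,11) by (auto simp: distributed_def)
  have \<epsilon> [measurable]: "\<epsilon> \<in> borel_measurable M"
    using indep_var_rv1[OF assms(6)] .
  have "(\<lambda>x. enn2real (ennreal (g x))) \<in> borel_measurable borel"
    using assms(11) by (intro borel_measurable_enn2real) (simp add: distributed_def)
  then have g [measurable]: "g \<in> borel_measurable borel" using assms(10) by simp
  have "prob ({\<omega> \<in> space M. \<epsilon> \<omega> = 1} \<union> {\<omega> \<in> space M. \<epsilon> \<omega> = - 1}) = 1"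
    using assms(7,8) by (subst finite_measure_Union) auto
  then have "AE \<omega> in M. \<omega> \<in> {\<omega> \<in> space M. \<epsilon> \<omega> = 1} \<union> {\<omega> \<in> space M. \<epsilon> \<omega> = - 1}"
    by (subst (asm) prob_eq_1) auto
  then have sq: "AE \<omega> in M. (Y \<omega>)\<^sup>2 = X \<omega>"
    using assms(2)
  proof eventually_elim
    case (elim \<omega>)
    then show ?case using assms(9)[of \<omega>] by (auto simp: power_mult_distrib)
  qed
  show ?thesis
  proof (rule M_indet_of_square_density[of _ g c])
    show "stieltjes_law (distr M borel X)"
      unfolding stieltjes_law_def using assms(2,5)
      by (auto simp: prob_space_distr AE_distr_iff integrable_distr_eq)
    show "emeasure (distr M borel X) {x} = 0" for x
    proof -
      have m: "(\<lambda>x. ennreal (f x)) \<in> borel_measurable lborel" and d: "distr M lborel X = density lborel (\<lambda>x. ennreal (f x))"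
        using assms(4) by (auto simp: distributed_def)
      have "emeasure (distr M borel X) {x} = emeasure (distr M lborel X) {x}"
        by (simp add: emeasure_distr)
      also have "\<dots> = (\<integral>\<^sup>+y\<in>{x}. ennreal (f y) \<partial>lborel)"
        unfolding d by (rule emeasure_density[OF m]) simp
      also have "\<dots> = 0" by (rule nn_integral_null_set) (simp add: null_sets_def)
      finally show ?thesis .
    qed
    show "integrable lborel (\<lambda>y. g y * h (y\<^sup>2)) \<and>
        (\<integral>t. h t \<partial>distr M borel X) = (\<integral>y. g y * h (y\<^sup>2) \<partial>lborel)"
      if [measurable]: "h \<in> borel_measurable borel" and h: "integrable (distr M borel X) h" for h :: "real \<Rightarrow> real"
    proof
      have ae: "AE \<omega> in M. h (X \<omega>) = h ((Y \<omega>)\<^sup>2)" using sq by eventually_elim simp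
      have "integrable M (\<lambda>\<omega>. h (X \<omega>))" using h by (simp add: integrable_distr_eq)
      then have "integrable M (\<lambda>\<omega>. h ((Y \<omega>)\<^sup>2))"
        by (rule integrable_cong_AE_imp) (use ae in \<open>auto elim: eventually_mono\<close>)
      then show "integrable lborel (\<lambda>y. g y * h (y\<^sup>2))"
        using distributed_integrable[OF assms(11), of "\<lambda>y. h (y\<^sup>2)"] assms(10) by simp
      have "(\<integral>t. h t \<partial>distr M borel X) = (\<integral>\<omega>. h (X \<omega>) \<partial>M)" by (simp add: integral_distr)
      also have "\<dots> = (\<integral>\<omega>. h ((Y \<omega>)\<^sup>2) \<partial>M)" using ae by (intro integral_cong_AE) auto
      also have "\<dots> = (\<integral>y. g y * h (y\<^sup>2) \<partial>lborel)"
        using distributed_integral[OF assms(11), of "\<lambda>y. h (y\<^sup>2)"] assms(10) by simp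
      finally show "(\<integral>t. h t \<partial>distr M borel X) = (\<integral>y. g y * h (y\<^sup>2) \<partial>lborel)" .
    qed
  qed (use assms in auto)
qed

end
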